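(* Let $a,t$ be real numbers with $(a-1)(t-1)\neq 0$ such that $\sigma^2:=\dfrac{t+3}{a\{(t-1)a+4\}}$ is well defined and satisfies $\sigma^2<0$, and let $\sigma$ be a square root of this number. On $M=\mathbb{P}^1(\mathbb{C})\setminus\{i,-i,\infty\}$ consider the algebraic minimal surface in $\mathbb{R}^3$ with Weierstrass data $$g(z)=\sigma\,\frac{z^2+1+a(t-1)}{z^2+t},\qquad h\,dz=\frac{(z^2+t)^2}{(z^2+1)^2}\,dz .$$ Then its Gauss map $g\colon M\to\mathbb{P}^1(\mathbb{C})$ has totally ramified value number $\nu_g=2.5$.
   Context: A minimal surface in $\mathbb{R}^3$ with Weierstrass data $(h\,dz,g)$ on a Riemann surface $M$ is the immersion $x(z)=\Re\int_{z_0}^z(\phi_1,\phi_2,\phi_3)$ with $\phi_1=\frac12(1-g^2)h\,dz$, $\phi_2=\frac{\sqrt{-1}}2(1+g^2)h\,dz$, $\phi_3=gh\,dz$; the meromorphic function $g$ is its Gauss map (composed with stereographic projection). An algebraic minimal surface is a complete minimal surface of finite total curvature. Totally ramified value number: for a non-constant meromorphic function $g\colon M\to\mathbb{P}^1(\mathbb{C})$, a value $b$ is called totally ramified if $g$ branches (has multiplicity $\ge 2$) at every point of $g^{-1}(b)\subset M$; exceptional (omitted) values are regarded as totally ramified. Let $a_1,\dots,a_{r_0}$ be the exceptional values and $b_1,\dots,b_{l_0}$ the non-exceptional totally ramified values, and let $\nu_j\ge 2$ be the minimum of the multiplicities of $g$ at the points of $g^{-1}(b_j)$. Then $\nu_g=r_0+\sum_{j=1}^{l_0}\bigl(1-\frac1{\nu_j}\bigr)$.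 *)

theory Defs
  imports "HOL-Analysis.Analysis" "HOL-Complex_Analysis.Complex_Analysis"
begin

text \<open>
  Riemann surfaces are restricted to domains \<open>M\<close> of the complex plane, the plane being
  identified with the complement of \<open>\<infinity>\<close> in the projective line. A holomorphic 1-form is
  represented by its coefficient with respect to \<open>dz\<close>.
\<close>

datatype projective_line = Fin complex | Infty

text \<open>
  A HOL function \<open>g\<close> that is meromorphic carries arbitrary values at its poles and removable
  singularities. The map into the projective line that it induces does not depend on them.
\<close>

definition sphere_map :: "(complex \<Rightarrow> complex) \<Rightarrow> complex \<Rightarrow> projective_line" where
  "sphere_map g z = (if is_pole g z then Infty else Fin (remove_sings g z))"

definition mult_at :: "(complex \<Rightarrow> complex) \<Rightarrow> complex \<Rightarrow> nat" where
  "mult_at g z = (if is_pole g z then nat (- zorder g z)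
                  else nat (zorder (\<lambda>w. g w - remove_sings g z) z))"

definition fibre :: "complex set \<Rightarrow> (complex \<Rightarrow> complex) \<Rightarrow> projective_line \<Rightarrow> complex set" where
  "fibre M g b = {z \<in> M. sphere_map g z = b}"

definition exceptional_value :: "complex set \<Rightarrow> (complex \<Rightarrow> complex) \<Rightarrow> projective_line \<Rightarrow> bool" where
  "exceptional_value M g b \<longleftrightarrow> fibre M g b = {}"

definition totally_ramified_value ::
    "complex set \<Rightarrow> (complex \<Rightarrow> complex) \<Rightarrow> projective_line \<Rightarrow> bool" where
  "totally_ramified_value M g b \<longleftrightarrow> (\<forall>z \<in> fibre M g b. mult_at g z \<ge> 2)"

definition min_mult :: "complex set \<Rightarrow> (complex \<Rightarrow> complex) \<Rightarrow> projective_line \<Rightarrow> nat" where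
  "min_mult M g b = (INF z \<in> fibre M g b. mult_at g z)"

text \<open>
  Meaningful only for non-constant \<open>g\<close> with finitely many totally ramified values;
  otherwise \<open>card\<close> and the sum may take their default value 0.
\<close>

definition totally_ramified_value_number :: "complex set \<Rightarrow> (complex \<Rightarrow> complex) \<Rightarrow> real" where
  "totally_ramified_value_number M g =
     real (card {b. exceptional_value M g b})
     + (\<Sum>b | totally_ramified_value M g b \<and> \<not> exceptional_value M g b.
          1 - 1 / real (min_mult M g b))"

text \<open>
  At a pole of \<open>g\<close> the coefficients below are the holomorphic extensions of the
  formulas, not the values that the formulas take there in HOL.
\<close>

definition weierstrass_phi1 :: "(complex \<Rightarrow> complex) \<Rightarrow> (complex \<Rightarrow> complex) \<Rightarrow> complex \<Rightarrow> complex" where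
  "weierstrass_phi1 h g = remove_sings (\<lambda>z. (1 - (g z)\<^sup>2) * h z / 2)"

definition weierstrass_phi2 :: "(complex \<Rightarrow> complex) \<Rightarrow> (complex \<Rightarrow> complex) \<Rightarrow> complex \<Rightarrow> complex" where
  "weierstrass_phi2 h g = remove_sings (\<lambda>z. \<i> * (1 + (g z)\<^sup>2) * h z / 2)"

definition weierstrass_phi3 :: "(complex \<Rightarrow> complex) \<Rightarrow> (complex \<Rightarrow> complex) \<Rightarrow> complex \<Rightarrow> complex" where
  "weierstrass_phi3 h g = remove_sings (\<lambda>z. g z * h z)"

definition path_integral ::
    "(complex \<Rightarrow> complex) \<Rightarrow> (complex \<Rightarrow> complex) \<Rightarrow> (real \<Rightarrow> complex) \<Rightarrow> real^3" where
  "path_integral h g \<gamma> = vector [Re (contour_integral \<gamma> (weierstrass_phi1 h g)),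
                               Re (contour_integral \<gamma> (weierstrass_phi2 h g)),
                               Re (contour_integral \<gamma> (weierstrass_phi3 h g))]"

text \<open>
  The last clause says that there are no real periods, i.e. that the real part of the
  integral is independent of the path.
\<close>

definition weierstrass_data :: "complex set \<Rightarrow> (complex \<Rightarrow> complex) \<Rightarrow> (complex \<Rightarrow> complex) \<Rightarrow> bool" where
  "weierstrass_data M h g \<longleftrightarrow>
     open M \<and> connected M \<and> h holomorphic_on M \<and> g meromorphic_on M \<and> \<not> g constant_on M \<and>
     weierstrass_phi1 h g holomorphic_on M \<and>
     weierstrass_phi2 h g holomorphic_on M \<and>
     weierstrass_phi3 h g holomorphic_on M \<and>
     (\<forall>\<gamma>. valid_path \<gamma> \<and> path_image \<gamma> \<subseteq> M \<and> pathfinish \<gamma> = pathstart \<gamma> \<longrightarrow> path_integral h g \<gamma> = 0)"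

definition weierstrass_immersion ::
    "complex set \<Rightarrow> complex \<Rightarrow> (complex \<Rightarrow> complex) \<Rightarrow> (complex \<Rightarrow> complex) \<Rightarrow> complex \<Rightarrow> real^3" where
  "weierstrass_immersion M z0 h g z =
     path_integral h g (SOME \<gamma>. valid_path \<gamma> \<and> path_image \<gamma> \<subseteq> M \<and>
                                pathstart \<gamma> = z0 \<and> pathfinish \<gamma> = z)"

text \<open>Partial derivatives with respect to the real coordinates \<open>z = u + \<i> v\<close>.\<close>

definition partial_u :: "(complex \<Rightarrow> real^3) \<Rightarrow> complex \<Rightarrow> real^3" where
  "partial_u X z = frechet_derivative X (at z) 1"

definition partial_v :: "(complex \<Rightarrow> real^3) \<Rightarrow> complex \<Rightarrow> real^3" where
  "partial_v X z = frechet_derivative X (at z) \<i>"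

definition C2_immersion_on :: "complex set \<Rightarrow> (complex \<Rightarrow> real^3) \<Rightarrow> bool" where
  "C2_immersion_on M X \<longleftrightarrow>
     (\<forall>z\<in>M. X differentiable (at z) \<and> partial_u X differentiable (at z) \<and>
            partial_v X differentiable (at z) \<and> inj (frechet_derivative X (at z))) \<and>
     continuous_on M (partial_u (partial_u X)) \<and> continuous_on M (partial_v (partial_u X)) \<and>
     continuous_on M (partial_u (partial_v X)) \<and> continuous_on M (partial_v (partial_v X))"

definition unit_normal :: "(complex \<Rightarrow> real^3) \<Rightarrow> complex \<Rightarrow> real^3" where
  "unit_normal X z = sgn (cross3 (partial_u X z) (partial_v X z))"

definition first_E :: "(complex \<Rightarrow> real^3) \<Rightarrow> complex \<Rightarrow> real" where
  "first_E X z = partial_u X z \<bullet> partial_u X z"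

definition first_F :: "(complex \<Rightarrow> real^3) \<Rightarrow> complex \<Rightarrow> real" where
  "first_F X z = partial_u X z \<bullet> partial_v X z"

definition first_G :: "(complex \<Rightarrow> real^3) \<Rightarrow> complex \<Rightarrow> real" where
  "first_G X z = partial_v X z \<bullet> partial_v X z"

definition second_L :: "(complex \<Rightarrow> real^3) \<Rightarrow> complex \<Rightarrow> real" where
  "second_L X z = partial_u (partial_u X) z \<bullet> unit_normal X z"

definition second_M :: "(complex \<Rightarrow> real^3) \<Rightarrow> complex \<Rightarrow> real" where
  "second_M X z = partial_v (partial_u X) z \<bullet> unit_normal X z"

definition second_N :: "(complex \<Rightarrow> real^3) \<Rightarrow> complex \<Rightarrow> real" where
  "second_N X z = partial_v (partial_v X) z \<bullet> unit_normal X z"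

definition gauss_curvature :: "(complex \<Rightarrow> real^3) \<Rightarrow> complex \<Rightarrow> real" where
  "gauss_curvature X z =
     (second_L X z * second_N X z - (second_M X z)\<^sup>2) /
     (first_E X z * first_G X z - (first_F X z)\<^sup>2)"

definition mean_curvature :: "(complex \<Rightarrow> real^3) \<Rightarrow> complex \<Rightarrow> real" where
  "mean_curvature X z =
     (first_E X z * second_N X z - 2 * first_F X z * second_M X z + first_G X z * second_L X z) /
     (2 * (first_E X z * first_G X z - (first_F X z)\<^sup>2))"

definition minimal_surface :: "complex set \<Rightarrow> (complex \<Rightarrow> real^3) \<Rightarrow> bool" where
  "minimal_surface M X \<longleftrightarrow> C2_immersion_on M X \<and> (\<forall>z\<in>M. mean_curvature X z = 0)"

text \<open>
  Completeness of the metric induced by \<open>X\<close>: every \<open>C\<^sup>1\<close> curve in \<open>M\<close> that eventually leaves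
  each compact subset of \<open>M\<close> has infinite length.
\<close>

definition complete_surface :: "complex set \<Rightarrow> (complex \<Rightarrow> real^3) \<Rightarrow> bool" where
  "complete_surface M X \<longleftrightarrow>
     (\<forall>\<gamma> :: real \<Rightarrow> complex.
        \<gamma> C1_differentiable_on {0..} \<and> \<gamma> ` {0..} \<subseteq> M \<and>
        (\<forall>K. compact K \<and> K \<subseteq> M \<longrightarrow> (\<forall>\<^sub>F s in at_top. \<gamma> s \<notin> K)) \<longrightarrow>
        (\<integral>\<^sup>+ s \<in> {0..}. ennreal (norm (vector_derivative (X \<circ> \<gamma>) (at s))) \<partial>lborel) = \<infinity>)"

definition finite_total_curvature :: "complex set \<Rightarrow> (complex \<Rightarrow> real^3) \<Rightarrow> bool" where
  "finite_total_curvature M X \<longleftrightarrow>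
     set_integrable lborel M
       (\<lambda>z. gauss_curvature X z * sqrt (first_E X z * first_G X z - (first_F X z)\<^sup>2))"

definition algebraic_minimal_surface :: "complex set \<Rightarrow> (complex \<Rightarrow> real^3) \<Rightarrow> bool" where
  "algebraic_minimal_surface M X \<longleftrightarrow>
     minimal_surface M X \<and> complete_surface M X \<and> finite_total_curvature M X"

text \<open>Stereographic projection from the north pole.\<close>

definition stereographic :: "real^3 \<Rightarrow> projective_line" where
  "stereographic p = (if p $ 3 = 1 then Infty
                      else Fin (Complex (p $ 1) (p $ 2) / of_real (1 - p $ 3)))"

definition gauss_map :: "(complex \<Rightarrow> real^3) \<Rightarrow> complex \<Rightarrow> projective_line" where
  "gauss_map X z = stereographic (unit_normal X z)"

end

theory Submission
  imports Defs "HOL-Probability.Sinc_Integral"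
begin

text \<open>
  Put \<open>h = p\<^sup>2\<close> and \<open>g = q / p\<close>. The Weierstrass forms become
  \<open>((p\<^sup>2 - q\<^sup>2) / 2, \<i> (p\<^sup>2 + q\<^sup>2) / 2, p q)\<close>, which are holomorphic wherever \<open>p\<close> and \<open>q\<close> are.
  With \<open>s = \<bar>p\<bar>\<^sup>2 + \<bar>q\<bar>\<^sup>2\<close> the metric is \<open>(s / 2)\<^sup>2 \<bar>dz\<bar>\<^sup>2\<close>, the second fundamental form is
  the real part of \<open>(p' q - p q') dz\<^sup>2\<close>, and the normal is \<open>q / p\<close> in stereographic coordinates.

  Here \<open>p = 1 + B / w\<close> and \<open>q = \<sigma> (1 + A / w)\<close> with \<open>w = z\<^sup>2 + 1\<close>, \<open>A = a (t - 1)\<close>, \<open>B = t - 1\<close>.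
  The real periods vanish because \<open>\<sigma>\<close> is purely imaginary and \<open>\<sigma>\<^sup>2\<close> has the prescribed value.
  Since \<open>A \<noteq> B\<close>, \<open>s\<close> is bounded below by a multiple of \<open>1 + 1 / \<bar>w\<bar>\<^sup>2\<close>; hence the functions \<open>z\<close> and
  \<open>z / w\<close>, which are jointly proper on \<open>M\<close>, stay bounded along curves of finite length. The total
  curvature density at \<open>z = x + \<i> y\<close> is \<open>O(1 / ((1 + x\<^sup>2) (1 + y\<^sup>2)))\<close>.

  As \<open>g\<close> is a Moebius transformation of \<open>z\<^sup>2\<close>, it branches only over its values at \<open>0\<close> and \<open>\<infinity>\<close>. It omits
  \<open>\<sigma> = g(\<infinity>)\<close> and \<open>\<sigma> a = g(\<i>) = g(-\<i>)\<close>, and takes \<open>g(0)\<close> only at \<open>0\<close>, with multiplicity two.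
\<close>

subsection \<open>Null curves in spinor form\<close>

definition re_vec :: "complex^3 \<Rightarrow> real^3" where
  "re_vec v = (\<chi> i. Re (v $ i))"

lemma re_vec_nth [simp]: "re_vec v $ i = Re (v $ i)"
  by (simp add: re_vec_def)

text \<open>A holomorphic derivative is complex linear, so its real part can be read off
  componentwise. The free factor \<open>c\<close> covers a vector field together with its rotation
  by \<open>\<i>\<close>.\<close>

lemma has_derivative_re_vec:
  fixes f :: "complex \<Rightarrow> complex^3"
  assumes "\<And>i. ((\<lambda>z. f z $ i) has_field_derivative f' $ i) (at z within S)"
  shows "((\<lambda>z. re_vec (c *s f z)) has_derivative (\<lambda>d. re_vec (d *s (c *s f')))) (at z within S)"
proof -
  have "((\<lambda>z. Re (c * f z $ i)) has_derivative (\<lambda>d. Re (d * (c * f' $ i)))) (at z within S)" for i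
    using assms[of i] unfolding has_field_derivative_def
    by (auto intro!: derivative_eq_intros simp: algebra_simps)
  then show ?thesis
    by (subst has_derivative_componentwise_within)
      (auto simp: Basis_vec_def inner_axis re_vec_def mult.assoc simp del: times_complex.sel)
qed

lemma partials_of_re_vec:
  assumes "(X has_derivative (\<lambda>d. re_vec (d *s v))) (at z)"
  shows "partial_u X z = re_vec v" "partial_v X z = re_vec (\<i> *s v)"
  by (simp_all add: partial_u_def partial_v_def flip: frechet_derivative_at[OF assms])

text \<open>The Weierstrass integrand with \<open>h = a\<^sup>2\<close> and
  \<open>g = b / a\<close>, cleared of denominators so that it stays valid at \<open>a = 0\<close>.
  The squares of its components sum to zero.\<close>

definition spinor_form :: "complex \<Rightarrow> complex \<Rightarrow> complex^3" where
  "spinor_form a b = vector [(a\<^sup>2 - b\<^sup>2) / 2, \<i> * (a\<^sup>2 + b\<^sup>2) / 2, a * b]"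

definition spinor_form_deriv :: "complex \<Rightarrow> complex \<Rightarrow> complex \<Rightarrow> complex \<Rightarrow> complex^3" where
  "spinor_form_deriv a b a' b' = vector [a * a' - b * b', \<i> * (a * a' + b * b'), a' * b + a * b']"

text \<open>Inverse stereographic projection of \<open>b / a\<close>, multiplied by
  \<open>(cmod a)\<^sup>2 + (cmod b)\<^sup>2\<close> so that \<open>a = 0\<close> needs no separate
  case.\<close>

definition spinor_normal :: "complex \<Rightarrow> complex \<Rightarrow> real^3" where
  "spinor_normal a b = vector [2 * Re (cnj a * b), 2 * Im (cnj a * b), (cmod b)\<^sup>2 - (cmod a)\<^sup>2]"

lemma spinor_form_has_field_derivative:
  assumes "(p has_field_derivative p') (at z)" "(q has_field_derivative q') (at z)"
  shows "((\<lambda>z. spinor_form (p z) (q z) $ i) has_field_derivative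
          spinor_form_deriv (p z) (q z) p' q' $ i) (at z)"
  using exhaust_3[of i]
  by (elim disjE; simp add: spinor_form_def spinor_form_deriv_def)
     (use assms in \<open>auto intro!: derivative_eq_intros simp: field_simps\<close>)

text \<open>Conformality comes from nullity: real and imaginary parts of a null vector are
  orthogonal and equally long. Here everything is checked by expansion in real coordinates.\<close>

lemma spinor_first_form:
  fixes a b :: complex
  defines "s \<equiv> (cmod a)\<^sup>2 + (cmod b)\<^sup>2"
  shows "re_vec (d *s spinor_form a b) \<bullet> re_vec (d *s spinor_form a b) = (cmod d * s / 2)\<^sup>2"
    and "re_vec (spinor_form a b) \<bullet> re_vec (\<i> *s spinor_form a b) = 0"
    and "cross3 (re_vec (spinor_form a b)) (re_vec (\<i> *s spinor_form a b)) = (s / 4) *\<^sub>R spinor_normal a b"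
    and "norm (spinor_normal a b) = s"
proof -
  have "re_vec (d *s spinor_form a b) \<bullet> re_vec (d *s spinor_form a b) = (cmod d)\<^sup>2 * s\<^sup>2 / 4"
    unfolding s_def
    by (cases a; cases b; cases d; simp add: inner_vec_def sum_3 spinor_form_def cmod_def power2_eq_square)
       (simp add: field_simps; fail | algebra)+
  then show "re_vec (d *s spinor_form a b) \<bullet> re_vec (d *s spinor_form a b) = (cmod d * s / 2)\<^sup>2"
    by (simp add: power_divide power_mult_distrib)
  show "re_vec (spinor_form a b) \<bullet> re_vec (\<i> *s spinor_form a b) = 0"
    by (cases a; cases b; simp add: inner_vec_def sum_3 spinor_form_def power2_eq_square field_simps)
  show "cross3 (re_vec (spinor_form a b)) (re_vec (\<i> *s spinor_form a b)) = (s / 4) *\<^sub>R spinor_normal a b"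
    unfolding s_def
    by (cases a; cases b; simp add: cross3_def vec_eq_iff forall_3 spinor_form_def spinor_normal_def
        cmod_def power2_eq_square field_simps)
  have "(norm (spinor_normal a b))\<^sup>2 = s\<^sup>2"
    unfolding s_def power2_norm_eq_inner[of "spinor_normal a b"]
    by (cases a; cases b; simp add: inner_vec_def sum_3 spinor_normal_def
        cmod_def power2_eq_square field_simps)
  then show "norm (spinor_normal a b) = s"
    by (simp add: s_def)
qed

text \<open>Pairing with the normal discards the tangential part and leaves the coefficient of the
  Hopf differential: \<open>a' * b - a * b'\<close> is \<open>- h g'\<close> when
  \<open>h = a\<^sup>2\<close> and \<open>g = b / a\<close>.\<close>

lemma spinor_second_form:
  fixes a b a' b' c :: complex
  shows "re_vec (c *s spinor_form_deriv a b a' b') \<bullet> spinor_normal a b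
       = ((cmod a)\<^sup>2 + (cmod b)\<^sup>2) * Re (c * (a' * b - a * b'))"
  unfolding cmod_power2 
  by (cases a; cases b; cases a'; cases b'; cases c; simp add: inner_vec_def sum_3 spinor_form_deriv_def spinor_normal_def
        cmod_power2) (simp add: power2_eq_square algebra_simps)

lemma spinor_stereographic:
  fixes a b :: complex
  assumes "a \<noteq> 0 \<or> b \<noteq> 0"
  shows "stereographic (sgn (spinor_normal a b)) = (if a = 0 then Infty else Fin (b / a))"
proof -
  define s where "s = (cmod a)\<^sup>2 + (cmod b)\<^sup>2"
  have s: "s > 0" using assms by (auto simp: s_def add_pos_nonneg add_nonneg_pos)
  have n: "sgn (spinor_normal a b) = (1 / s) *\<^sub>R spinor_normal a b"
    by (simp add: sgn_div_norm spinor_first_form(4) s_def divide_inverse)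
  have n3: "1 - sgn (spinor_normal a b) $ 3 = 2 * (cmod a)\<^sup>2 / s"
    using s unfolding n by (simp add: spinor_normal_def field_simps) (simp add: s_def)
  have n12: "Complex (sgn (spinor_normal a b) $ 1) (sgn (spinor_normal a b) $ 2) = of_real (2 / s) * (cnj a * b)"
    unfolding n by (simp add: spinor_normal_def complex_eq_iff)
  show ?thesis
  proof (cases "a = 0")
    case True
    then show ?thesis using n3 by (simp add: stereographic_def)
  next
    case False
    then have "sgn (spinor_normal a b) $ 3 \<noteq> 1" using n3 s by auto
    moreover have "of_real (2 / s) * (cnj a * b) / of_real (2 * (cmod a)\<^sup>2 / s) = b / a"
      using False s by (simp add: field_simps flip: complex_norm_square)
    ultimately show ?thesis using False by (simp add: stereographic_def n12 n3)
  qed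
qed

subsection \<open>Geometry of a surface with spinor data\<close>

text \<open>\<open>X\<close> enters only through its differential, so the base point and the choice
  of a primitive do not matter.\<close>

locale spinor_immersion =
  fixes M :: "complex set" and p q :: "complex \<Rightarrow> complex" and X :: "complex \<Rightarrow> real^3"
  assumes open_M: "open M"
    and p_holomorphic: "p holomorphic_on M" and q_holomorphic: "q holomorphic_on M"
    and no_common_zero: "\<And>z. z \<in> M \<Longrightarrow> p z \<noteq> 0 \<or> q z \<noteq> 0"
    and X_has_derivative:
      "\<And>z. z \<in> M \<Longrightarrow> (X has_derivative (\<lambda>d. re_vec (d *s spinor_form (p z) (q z)))) (at z)"
begin

definition weight :: "complex \<Rightarrow> real" where
  "weight z = (cmod (p z))\<^sup>2 + (cmod (q z))\<^sup>2"

definition wronskian :: "complex \<Rightarrow> complex" where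
  "wronskian z = deriv p z * q z - p z * deriv q z"

abbreviation form_deriv :: "complex \<Rightarrow> complex^3" where
  "form_deriv z \<equiv> spinor_form_deriv (p z) (q z) (deriv p z) (deriv q z)"

lemma weight_pos: "z \<in> M \<Longrightarrow> weight z > 0"
  using no_common_zero[of z] by (auto simp: weight_def add_pos_nonneg add_nonneg_pos)

section \<open>First and second derivatives\<close>

lemma partial_u_X: "z \<in> M \<Longrightarrow> partial_u X z = re_vec (spinor_form (p z) (q z))"
  and partial_v_X: "z \<in> M \<Longrightarrow> partial_v X z = re_vec (\<i> *s spinor_form (p z) (q z))"
  using partials_of_re_vec[OF X_has_derivative] by simp_all

text \<open>The cases \<open>c = 1\<close> and \<open>c = \<i>\<close> are the two partial
  derivatives of \<open>X\<close>. Agreement on \<open>M\<close> suffices because \<open>M\<close>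
  is open.\<close>

lemma has_derivative_re_vec_form:
  assumes "z \<in> M" and "\<And>w. w \<in> M \<Longrightarrow> f w = re_vec (c *s spinor_form (p w) (q w))"
  shows "(f has_derivative (\<lambda>d. re_vec (d *s (c *s form_deriv z)))) (at z)"
proof (rule has_derivative_transform_within_open[OF _ open_M \<open>z \<in> M\<close>])
  have "(p has_field_derivative deriv p z) (at z)" "(q has_field_derivative deriv q z) (at z)"
    using assms(1) open_M p_holomorphic q_holomorphic holomorphic_derivI by blast+
  then show "((\<lambda>w. re_vec (c *s spinor_form (p w) (q w))) has_derivative
      (\<lambda>d. re_vec (d *s (c *s form_deriv z)))) (at z)"
    by (intro has_derivative_re_vec spinor_form_has_field_derivative)
qed (simp add: assms(2))

lemma partial_u_X_has_derivative:
  "z \<in> M \<Longrightarrow> (partial_u X has_derivative (\<lambda>d. re_vec (d *s form_deriv z))) (at z)"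
  using has_derivative_re_vec_form[of z "partial_u X" 1] by (simp add: partial_u_X)

lemma partial_v_X_has_derivative:
  "z \<in> M \<Longrightarrow> (partial_v X has_derivative (\<lambda>d. re_vec (d *s (\<i> *s form_deriv z)))) (at z)"
  using has_derivative_re_vec_form[of z "partial_v X" \<i>] by (simp add: partial_v_X)

lemma second_partials:
  assumes "z \<in> M"
  shows "partial_u (partial_u X) z = re_vec (form_deriv z)"
    and "partial_v (partial_u X) z = re_vec (\<i> *s form_deriv z)"
    and "partial_u (partial_v X) z = re_vec (\<i> *s form_deriv z)"
    and "partial_v (partial_v X) z = re_vec ((- 1) *s form_deriv z)"
  using partials_of_re_vec[OF partial_u_X_has_derivative[OF assms]]
    partials_of_re_vec[OF partial_v_X_has_derivative[OF assms]]
  by (simp_all add: vector_smult_assoc)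

section \<open>Fundamental forms, curvature and Gauss map\<close>

lemma first_form:
  assumes "z \<in> M"
  shows "first_E X z = (weight z / 2)\<^sup>2" "first_F X z = 0" "first_G X z = (weight z / 2)\<^sup>2"
  using spinor_first_form(1)[of 1 "p z" "q z"] spinor_first_form(1)[of \<i> "p z" "q z"]
    spinor_first_form(2)[of "p z" "q z"] assms
  by (simp_all add: first_E_def first_F_def first_G_def partial_u_X partial_v_X weight_def)

lemma area_element:
  assumes "z \<in> M"
  shows "first_E X z * first_G X z - (first_F X z)\<^sup>2 = ((weight z / 2)\<^sup>2)\<^sup>2"
  by (simp add: first_form[OF assms] power2_eq_square)

lemma unit_normal_X:
  assumes "z \<in> M"
  shows "unit_normal X z = sgn (spinor_normal (p z) (q z))"
  using assms weight_pos[OF assms]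
  by (simp add: unit_normal_def partial_u_X partial_v_X spinor_first_form(3) sgn_scaleR flip: weight_def)

text \<open>The factor in \<open>spinor_second_form\<close> cancels the length of the normal. Taking
  \<open>c\<close> to be 1, \<open>\<i>\<close> and -1 yields all coefficients of the second
  fundamental form.\<close>

lemma re_vec_form_deriv_inner_normal:
  assumes "z \<in> M"
  shows "re_vec (c *s form_deriv z) \<bullet> unit_normal X z = Re (c * wronskian z)"
  using weight_pos[OF assms]
  by (simp add: unit_normal_X[OF assms] sgn_div_norm spinor_first_form(4) spinor_second_form
      wronskian_def flip: weight_def)

lemma second_form:
  assumes "z \<in> M"
  shows "second_L X z = Re (wronskian z)" "second_M X z = - Im (wronskian z)"
    "second_N X z = - Re (wronskian z)"
  using re_vec_form_deriv_inner_normal[OF assms, of 1] re_vec_form_deriv_inner_normal[OF assms, of \<i>]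
    re_vec_form_deriv_inner_normal[OF assms, of "- 1"]
  by (simp_all add: second_L_def second_M_def second_N_def second_partials[OF assms])

text \<open>The second form is the real part of a quadratic differential, hence trace free with
  respect to a conformal metric.\<close>

lemma mean_curvature_X: "z \<in> M \<Longrightarrow> mean_curvature X z = 0"
  by (simp add: mean_curvature_def first_form second_form)

text \<open>Where \<open>p\<close> does not vanish, this is minus the area density that the Gauss
  map \<open>q / p\<close> pulls back from the unit sphere.\<close>

lemma total_curvature_density:
  assumes "z \<in> M"
  shows "gauss_curvature X z * sqrt (first_E X z * first_G X z - (first_F X z)\<^sup>2)
       = - 4 * (cmod (wronskian z))\<^sup>2 / (weight z)\<^sup>2"
proof -
  have "second_L X z * second_N X z - (second_M X z)\<^sup>2 = - (cmod (wronskian z))\<^sup>2"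
    by (simp add: second_form[OF assms] cmod_power2) (simp add: power2_eq_square)
  then have "gauss_curvature X z * sqrt (first_E X z * first_G X z - (first_F X z)\<^sup>2)
      = - (cmod (wronskian z))\<^sup>2 / ((weight z / 2)\<^sup>2)\<^sup>2 * (weight z / 2)\<^sup>2"
    by (simp only: gauss_curvature_def area_element[OF assms] real_sqrt_abs abs_power2)
  then show ?thesis
    using weight_pos[OF assms] by (simp add: power2_eq_square)
qed

lemma gauss_map_X:
  assumes "z \<in> M"
  shows "gauss_map X z = (if p z = 0 then Infty else Fin (q z / p z))"
  using spinor_stereographic[OF no_common_zero[OF assms]]
  by (simp add: gauss_map_def unit_normal_X[OF assms])

lemma C2_immersion_X: "C2_immersion_on M X"
proof -
  have "inj (frechet_derivative X (at z))" if "z \<in> M" for z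
  proof -
    note X = X_has_derivative[OF that]
    \<comment> \<open>The differential scales lengths by \<open>weight z / 2\<close>, which is
      positive, so its kernel is trivial.\<close>
    have "d = 0" if "frechet_derivative X (at z) d = 0" for d
      using spinor_first_form(1)[of d "p z" "q z"] that weight_pos[OF \<open>z \<in> M\<close>]
      unfolding frechet_derivative_at[OF X, symmetric] by (simp flip: weight_def)
    moreover have "linear (frechet_derivative X (at z))"
      using X by (metis frechet_derivative_at has_derivative_linear)
    ultimately show ?thesis
      by (simp add: linear_injective_0)
  qed
  moreover have "continuous_on M (\<lambda>z. re_vec (c *s form_deriv z))" for c
  proof -
    have "continuous_on M (\<lambda>z. form_deriv z $ i)" for i
      using exhaust_3[of i] holomorphic_on_imp_continuous_on[OF p_holomorphic]
        holomorphic_on_imp_continuous_on[OF q_holomorphic]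
        holomorphic_on_imp_continuous_on[OF holomorphic_deriv[OF p_holomorphic open_M]]
        holomorphic_on_imp_continuous_on[OF holomorphic_deriv[OF q_holomorphic open_M]]
      by (elim disjE; simp add: spinor_form_deriv_def) (intro continuous_intros; assumption)+
    then show ?thesis
      unfolding re_vec_def vector_smult_component by (intro continuous_on_vec_lambda continuous_on_Re continuous_on_mult continuous_on_const)
  qed
  from this[of 1] this[of \<i>] this[of "- 1"]
  have "continuous_on M (partial_u (partial_u X))" "continuous_on M (partial_v (partial_u X))"
    "continuous_on M (partial_u (partial_v X))" "continuous_on M (partial_v (partial_v X))"
    by (simp_all add: second_partials cong: continuous_on_cong)
  ultimately show ?thesis
    using X_has_derivative partial_u_X_has_derivative partial_v_X_has_derivative
    unfolding C2_immersion_on_def differentiable_def by blast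
qed

lemma minimal_surface_X: "minimal_surface M X"
  by (simp add: minimal_surface_def C2_immersion_X mean_curvature_X)

lemma speed_X:
  assumes "(\<gamma> has_vector_derivative v) (at s)" "\<gamma> s \<in> M"
  shows "norm (vector_derivative (X \<circ> \<gamma>) (at s)) = cmod v * weight (\<gamma> s) / 2"
proof -
  have "(X \<circ> \<gamma> has_derivative (\<lambda>d. re_vec (d *\<^sub>R v *s spinor_form (p (\<gamma> s)) (q (\<gamma> s))))) (at s)"
    using diff_chain_at[OF assms(1)[unfolded has_vector_derivative_def] X_has_derivative[OF assms(2)]]
    by (simp add: o_def)
  moreover have "re_vec (d *\<^sub>R v *s w) = d *\<^sub>R re_vec (v *s w)" for d w
    by (simp add: vec_eq_iff algebra_simps)
  ultimately have "vector_derivative (X \<circ> \<gamma>) (at s) = re_vec (v *s spinor_form (p (\<gamma> s)) (q (\<gamma> s)))"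
    by (intro vector_derivative_at) (simp add: has_vector_derivative_def)
  moreover have "norm (re_vec (v *s spinor_form (p (\<gamma> s)) (q (\<gamma> s)))) = cmod v * weight (\<gamma> s) / 2"
    using weight_pos[OF assms(2)] spinor_first_form(1)[of v "p (\<gamma> s)" "q (\<gamma> s)"]
    unfolding norm_eq_sqrt_inner[of "re_vec _"] by (simp flip: weight_def)
  ultimately show ?thesis by simp
qed

text \<open>
  A curve of finite length keeps every function whose differential is dominated by the metric
  bounded, so it cannot leave all compact sets if such functions together are proper.
\<close>

lemma complete_surfaceI:
  fixes F :: "(complex \<Rightarrow> complex) set"
  assumes holF: "\<And>f. f \<in> F \<Longrightarrow> f holomorphic_on M"
    and bound: "\<And>f z. f \<in> F \<Longrightarrow> z \<in> M \<Longrightarrow> cmod (deriv f z) \<le> C * weight z"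
    and proper: "\<And>R. \<exists>K. compact K \<and> K \<subseteq> M \<and> {z \<in> M. \<forall>f\<in>F. cmod (f z) \<le> R f} \<subseteq> K"
  shows "complete_surface M X"
  unfolding complete_surface_def
proof (intro allI impI, elim conjE)
  fix \<gamma> :: "real \<Rightarrow> complex"
  assume C1: "\<gamma> C1_differentiable_on {0..}" and img: "\<gamma> ` {0..} \<subseteq> M"
    and leave: "\<forall>K. compact K \<and> K \<subseteq> M \<longrightarrow> (\<forall>\<^sub>F s in at_top. \<gamma> s \<notin> K)"
  define len where "len = (\<integral>\<^sup>+ s \<in> {0..}. ennreal (norm (vector_derivative (X \<circ> \<gamma>) (at s))) \<partial>lborel)"
  obtain D where D: "\<And>s. s \<ge> 0 \<Longrightarrow> (\<gamma> has_vector_derivative D s) (at s)" and contD: "continuous_on {0..} D"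
    using C1 unfolding C1_differentiable_on_def by auto
  have in_M: "\<gamma> s \<in> M" if "s \<ge> 0" for s using img that by auto
  define v where "v s = cmod (D s) * weight (\<gamma> s) / 2" for s
  have v: "norm (vector_derivative (X \<circ> \<gamma>) (at s)) = v s" if "s \<ge> 0" for s
    using speed_X[OF D in_M] that by (simp add: v_def)
  have cont\<gamma>: "continuous_on {0..} \<gamma>"
    using D by (meson atLeast_iff continuous_at_imp_continuous_on has_vector_derivative_continuous)
  have cont_comp: "continuous_on {0..} (\<lambda>s. f (\<gamma> s))" if "f holomorphic_on M" for f
    using continuous_on_compose2[OF holomorphic_on_imp_continuous_on[OF that] cont\<gamma>] img by auto
  have contv: "continuous_on {0..} v"
    unfolding v_def weight_def
    by (intro continuous_intros contD cont_comp p_holomorphic q_holomorphic) auto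
  have v0: "v s \<ge> 0" if "s \<ge> 0" for s
    using v[OF that] by (metis norm_ge_zero)
  \<comment> \<open>This links the gauge integral, to which the fundamental theorem of calculus
    applies, with the nonnegative integral that defines the length.\<close>
  have int_le: "ennreal (integral {0..T} v) \<le> len" if "T \<ge> 0" for T
  proof -
    have "set_integrable lborel {0..T} v"
      by (rule borel_integrable_atLeastAtMost') (use contv in \<open>auto intro: continuous_on_subset\<close>)
    have "integral {0..T} v = (LINT s:{0..T}|lborel. v s)"
      using \<open>set_integrable lborel {0..T} v\<close> by (simp add: set_borel_integral_eq_integral)
    also have "ennreal \<dots> = (\<integral>\<^sup>+ s. ennreal (indicator {0..T} s *\<^sub>R v s) \<partial>lborel)"
      using \<open>set_integrable lborel {0..T} v\<close> v0 unfolding set_lebesgue_integral_def set_integrable_def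
      by (intro nn_integral_eq_integral[symmetric]) (auto simp: indicator_def)
    also have "\<dots> \<le> len"
      unfolding len_def by (intro nn_integral_mono) (auto simp: indicator_def v)
    finally show ?thesis .
  qed
  show "len = \<infinity>"
  proof (rule ccontr)
    assume "len \<noteq> \<infinity>"
    then obtain l where l: "len = ennreal l" "l \<ge> 0"
      by (cases len) auto
    have int_l: "integral {0..T} v \<le> l" if "T \<ge> 0" for T
      using int_le[OF that] l by simp
    \<comment> \<open>The factor 2 undoes the half in \<open>v\<close>; the absolute value allows
      \<open>C\<close> to have any sign.\<close>
    have f_bound: "cmod (f (\<gamma> T)) \<le> cmod (f (\<gamma> 0)) + 2 * \<bar>C\<bar> * l" if "f \<in> F" "T \<ge> 0" for f T
    proof -
      have "((\<lambda>s. f (\<gamma> s)) has_vector_derivative D s * deriv f (\<gamma> s)) (at s within {0..T})" if "s \<in> {0..T}" for s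
        using field_vector_diff_chain_at[OF D holomorphic_derivI[OF holF open_M in_M]] \<open>f \<in> F\<close> that
        by (auto simp: o_def intro: has_vector_derivative_at_within)
      then have I: "((\<lambda>s. D s * deriv f (\<gamma> s)) has_integral f (\<gamma> T) - f (\<gamma> 0)) {0..T}"
        using \<open>T \<ge> 0\<close> by (intro fundamental_theorem_of_calculus) auto
      have vI: "v integrable_on {0..T}"
        using contv by (intro integrable_continuous_interval) (auto intro: continuous_on_subset)
      have "norm (integral {0..T} (\<lambda>s. D s * deriv f (\<gamma> s))) \<le> integral {0..T} (\<lambda>s. 2 * \<bar>C\<bar> * v s)"
      proof (rule integral_norm_bound_integral)
        show "(\<lambda>s. D s * deriv f (\<gamma> s)) integrable_on {0..T}" using I by blast
        show "(\<lambda>s. 2 * \<bar>C\<bar> * v s) integrable_on {0..T}"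
          using integrable_on_cmult_left[OF vI] by simp
        fix s assume s: "s \<in> {0..T}"
        have "cmod (deriv f (\<gamma> s)) \<le> C * weight (\<gamma> s)"
          using bound[OF \<open>f \<in> F\<close>] in_M s by simp
        also have "\<dots> \<le> \<bar>C\<bar> * weight (\<gamma> s)"
          using weight_pos[of "\<gamma> s"] in_M s by (intro mult_right_mono) auto
        finally have "cmod (deriv f (\<gamma> s)) \<le> \<bar>C\<bar> * weight (\<gamma> s)" .
        from mult_left_mono[OF this, of "cmod (D s)"]
        show "norm (D s * deriv f (\<gamma> s)) \<le> 2 * \<bar>C\<bar> * v s"
          by (simp add: v_def norm_mult algebra_simps)
      qed
      also have "\<dots> \<le> 2 * \<bar>C\<bar> * l"
        using int_l[OF \<open>T \<ge> 0\<close>] by (simp add: mult_left_mono)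
      finally have "cmod (f (\<gamma> T) - f (\<gamma> 0)) \<le> 2 * \<bar>C\<bar> * l"
        using I by (simp add: integral_unique)
      then show ?thesis
        by (smt (verit) norm_triangle_sub)
    qed
    obtain K where K: "compact K" "K \<subseteq> M"
      "{z \<in> M. \<forall>f\<in>F. cmod (f z) \<le> cmod (f (\<gamma> 0)) + 2 * \<bar>C\<bar> * l} \<subseteq> K"
      using proper[of "\<lambda>f. cmod (f (\<gamma> 0)) + 2 * \<bar>C\<bar> * l"] by blast
    have "\<forall>\<^sub>F s in at_top. \<gamma> s \<notin> K" using leave K by blast
    then obtain N where "\<And>s. s \<ge> N \<Longrightarrow> \<gamma> s \<notin> K"
      by (auto simp: eventually_at_top_linorder)
    then have "\<gamma> (max N 0) \<notin> K" by simp
    moreover have "\<gamma> (max N 0) \<in> K"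
      using K(3) f_bound[of _ "max N 0"] in_M[of "max N 0"] by auto
    ultimately show False by simp
  qed
qed

end

subsection \<open>Weierstrass integrals\<close>

text \<open>\<open>remove_sings\<close> depends only on the limit along a punctured neighbourhood,
  and continuity of \<open>f'\<close> identifies that limit.\<close>

lemma remove_sings_eqI_eventually:
  assumes "\<forall>\<^sub>F w in at z. f w = f' w" "isCont f' z"
  shows "remove_sings f z = f' z"
  using assms by (intro remove_sings_eqI) (simp add: isCont_def tendsto_cong)

text \<open>The fundamental theorem is applied to the real function \<open>F\<close> along the path,
  away from finitely many corners. Only the real part needs a primitive, so imaginary periods are
  allowed.\<close>

lemma Re_contour_integral_eq_diff:
  fixes f :: "complex \<Rightarrow> complex" and F :: "complex \<Rightarrow> real"
  assumes "open M" "f holomorphic_on M"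
    and F: "\<And>z. z \<in> M \<Longrightarrow> (F has_derivative (\<lambda>d. Re (d * f z))) (at z)"
    and \<gamma>: "valid_path \<gamma>" "path_image \<gamma> \<subseteq> M"
  shows "Re (contour_integral \<gamma> f) = F (pathfinish \<gamma>) - F (pathstart \<gamma>)"
proof -
  have in_M: "\<gamma> s \<in> M" if "s \<in> {0..1}" for s
    using \<gamma>(2) that by (auto simp: path_image_def)
  obtain S where S: "finite S" "\<gamma> C1_differentiable_on {0..1} - S"
    using \<gamma>(1) unfolding valid_path_def piecewise_C1_differentiable_on_def by blast
  have "((\<lambda>s. Re (f (\<gamma> s) * vector_derivative \<gamma> (at s))) has_integral (F \<circ> \<gamma>) 1 - (F \<circ> \<gamma>) 0) {0..1}"
  proof (rule fundamental_theorem_of_calculus_interior_strong[OF S(1)])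
    fix s assume s: "s \<in> {0<..<1} - S"
    then have "(\<gamma> has_vector_derivative vector_derivative \<gamma> (at s)) (at s)"
      using S(2) by (auto simp: C1_differentiable_on_eq vector_derivative_works[symmetric])
    from diff_chain_at[OF this[unfolded has_vector_derivative_def] F[OF in_M]]
    have "(F \<circ> \<gamma> has_derivative (\<lambda>d. Re (d *\<^sub>R vector_derivative \<gamma> (at s) * f (\<gamma> s)))) (at s)"
      using s by (simp add: o_def del: times_complex.sel)
    moreover have "(\<lambda>d. Re (d *\<^sub>R vector_derivative \<gamma> (at s) * f (\<gamma> s)))
        = (\<lambda>d. d *\<^sub>R Re (f (\<gamma> s) * vector_derivative \<gamma> (at s)))"
      by (auto simp: fun_eq_iff algebra_simps)
    ultimately show "(F \<circ> \<gamma> has_vector_derivative Re (f (\<gamma> s) * vector_derivative \<gamma> (at s))) (at s)"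
      by (simp only: has_vector_derivative_def)
  next
    have "continuous_on M F"
      using F by (meson continuous_at_imp_continuous_on has_derivative_continuous)
    then show "continuous_on {0..1} (F \<circ> \<gamma>)"
      using valid_path_imp_path[OF \<gamma>(1)] \<gamma>(2)
      by (intro continuous_on_compose) (auto simp: path_def path_image_def intro: continuous_on_subset)
  qed simp
  moreover have "f contour_integrable_on \<gamma>"
    using assms by (intro contour_integrable_holomorphic_simple)
  from has_integral_linear[OF has_contour_integral_integral[OF this, unfolded has_contour_integral] bounded_linear_Re]
  have "((\<lambda>s. Re (f (\<gamma> s) * vector_derivative \<gamma> (at s))) has_integral Re (contour_integral \<gamma> f)) {0..1}"
    by (simp add: o_def)
  ultimately show ?thesis
    by (auto simp: pathstart_def pathfinish_def dest: has_integral_unique)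
qed

text \<open>The formula for \<open>g\<close> is required only off the zeros of \<open>p\<close>,
  since at a pole the HOL value is arbitrary. The single-valued \<open>F\<close> encodes the absence
  of real periods.\<close>

locale weierstrass_spinor =
  fixes M :: "complex set" and p q g h :: "complex \<Rightarrow> complex" and F :: "complex \<Rightarrow> real^3"
  assumes open_M: "open M" and connected_M: "connected M"
    and p_holomorphic: "p holomorphic_on M" and q_holomorphic: "q holomorphic_on M"
    and no_common_zero: "\<And>z. z \<in> M \<Longrightarrow> p z \<noteq> 0 \<or> q z \<noteq> 0"
    and zeros_isolated: "\<And>z. z \<in> M \<Longrightarrow> \<forall>\<^sub>F w in at z. p w \<noteq> 0"
    and h_eq: "\<And>z. z \<in> M \<Longrightarrow> h z = (p z)\<^sup>2"
    and g_eq: "\<And>z. z \<in> M \<Longrightarrow> p z \<noteq> 0 \<Longrightarrow> g z = q z / p z"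
    and F_has_derivative:
      "\<And>z. z \<in> M \<Longrightarrow> (F has_derivative (\<lambda>d. re_vec (d *s spinor_form (p z) (q z)))) (at z)"
begin

lemma form_holomorphic: "(\<lambda>z. spinor_form (p z) (q z) $ i) holomorphic_on M"
  using exhaust_3[of i] p_holomorphic q_holomorphic
  by (elim disjE; simp add: spinor_form_def; intro holomorphic_intros; simp)

text \<open>Off the isolated zeros of \<open>p\<close> the Weierstrass formulas are the spinor form,
  which is continuous and therefore also gives the extension to those zeros.\<close>

lemma weierstrass_phi_eq:
  assumes "z \<in> M"
  shows "weierstrass_phi1 h g z = spinor_form (p z) (q z) $ 1"
    "weierstrass_phi2 h g z = spinor_form (p z) (q z) $ 2"
    "weierstrass_phi3 h g z = spinor_form (p z) (q z) $ 3"
proof -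
  have cont: "isCont (\<lambda>w. spinor_form (p w) (q w) $ i) z" for i
    using form_holomorphic[of i] open_M assms
    by (meson continuous_on_eq_continuous_at holomorphic_on_imp_continuous_on)
  have ev: "\<forall>\<^sub>F w in at z. w \<in> M \<and> p w \<noteq> 0"
    using zeros_isolated[OF assms] eventually_at_in_open'[OF open_M assms] by eventually_elim simp
  show "weierstrass_phi1 h g z = spinor_form (p z) (q z) $ 1"
    unfolding weierstrass_phi1_def
    by (rule remove_sings_eqI_eventually[OF eventually_mono[OF ev] cont])
       (auto simp: spinor_form_def h_eq g_eq field_simps)
  show "weierstrass_phi2 h g z = spinor_form (p z) (q z) $ 2"
    unfolding weierstrass_phi2_def
    by (rule remove_sings_eqI_eventually[OF eventually_mono[OF ev] cont])
       (auto simp: spinor_form_def h_eq g_eq field_simps)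
  show "weierstrass_phi3 h g z = spinor_form (p z) (q z) $ 3"
    unfolding weierstrass_phi3_def
    by (rule remove_sings_eqI_eventually[OF eventually_mono[OF ev] cont])
       (auto simp: spinor_form_def h_eq g_eq power2_eq_square)
qed

lemma path_integral_eq:
  assumes "valid_path \<gamma>" "path_image \<gamma> \<subseteq> M"
  shows "path_integral h g \<gamma> = F (pathfinish \<gamma>) - F (pathstart \<gamma>)"
proof -
  have component: "Re (contour_integral \<gamma> (\<lambda>z. spinor_form (p z) (q z) $ i))
      = F (pathfinish \<gamma>) $ i - F (pathstart \<gamma>) $ i" for i
  proof (rule Re_contour_integral_eq_diff[OF open_M form_holomorphic _ assms])
    fix z assume "z \<in> M"
    from bounded_linear.has_derivative[OF bounded_linear_vec_nth F_has_derivative[OF this]]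
    show "((\<lambda>z. F z $ i) has_derivative (\<lambda>d. Re (d * spinor_form (p z) (q z) $ i))) (at z)"
      by (simp del: times_complex.sel)
  qed
  have cong: "contour_integral \<gamma> f = contour_integral \<gamma> f'" if "\<And>z. z \<in> M \<Longrightarrow> f z = f' z" for f f'
    using that assms(2) by (intro contour_integral_eq) auto
  show ?thesis
    unfolding path_integral_def vec_eq_iff forall_3
    by (simp add: component cong[OF weierstrass_phi_eq(1)] cong[OF weierstrass_phi_eq(2)]
        cong[OF weierstrass_phi_eq(3)])
qed

lemma weierstrass_dataI:
  assumes "g meromorphic_on M" "\<not> g constant_on M"
  shows "weierstrass_data M h g"
proof -
  have "h holomorphic_on M"
    using p_holomorphic by (subst holomorphic_cong[OF refl h_eq]) (auto intro: holomorphic_intros)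
  moreover have "weierstrass_phi1 h g holomorphic_on M"
    "weierstrass_phi2 h g holomorphic_on M" "weierstrass_phi3 h g holomorphic_on M"
    using form_holomorphic weierstrass_phi_eq by (simp_all cong: holomorphic_cong)
  ultimately show ?thesis
    using assms open_M connected_M by (auto simp: weierstrass_data_def path_integral_eq)
qed

text \<open>Connectedness supplies a path for the choice operator, and path independence makes the
  choice irrelevant.\<close>

lemma weierstrass_immersion_eq:
  assumes "z0 \<in> M" "z \<in> M"
  shows "weierstrass_immersion M z0 h g z = F z - F z0"
proof -
  have "\<exists>\<gamma>. valid_path \<gamma> \<and> path_image \<gamma> \<subseteq> M \<and> pathstart \<gamma> = z0 \<and> pathfinish \<gamma> = z"
    using connected_open_polynomial_connected[OF open_M connected_M assms]
    by (metis valid_path_polynomial_function)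
  from someI_ex[OF this] show ?thesis
    by (simp add: weierstrass_immersion_def path_integral_eq)
qed

lemma spinor_immersion_weierstrass:
  assumes "z0 \<in> M"
  shows "spinor_immersion M p q (weierstrass_immersion M z0 h g)"
proof
  fix z assume "z \<in> M"
  have "((\<lambda>z. F z - F z0) has_derivative (\<lambda>d. re_vec (d *s spinor_form (p z) (q z)))) (at z)"
    using F_has_derivative[OF \<open>z \<in> M\<close>] by (auto intro!: derivative_eq_intros)
  then show "(weierstrass_immersion M z0 h g has_derivative (\<lambda>d. re_vec (d *s spinor_form (p z) (q z)))) (at z)"
    by (rule has_derivative_transform_within_open[OF _ open_M \<open>z \<in> M\<close>])
       (simp add: weierstrass_immersion_eq[OF assms])
qed (use open_M p_holomorphic q_holomorphic no_common_zero in auto)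

end

subsection \<open>Estimates and primitives\<close>

text \<open>The majorant is a product of two integrable functions of one real variable, so its
  integral over the plane factors.\<close>

lemma integrable_lborel_complex_bound:
  fixes f :: "complex \<Rightarrow> real"
  assumes [measurable]: "f \<in> borel_measurable borel"
    and bound: "\<And>z. \<bar>f z\<bar> \<le> C / ((1 + (Re z)\<^sup>2) * (1 + (Im z)\<^sup>2))"
  shows "integrable lborel f"
proof -
  define k where "k x = inverse (1 + x\<^sup>2)" for x :: real
  have k0: "k x \<ge> 0" for x by (simp add: k_def)
  have [measurable]: "k \<in> borel_measurable borel" unfolding k_def by measurable
  have "integrable lborel k"
    using integrable_inverse_1_plus_square
    by (simp add: k_def[abs_def] set_integrable_def einterval_def cong: if_cong)
  then have fin: "(\<integral>\<^sup>+ x. ennreal (k x) \<partial>lborel) < \<infinity>"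
    using k0 by (simp add: nn_integral_eq_integral)
  have prod: "ennreal (\<bar>C\<bar> * (k (Re z) * k (Im z))) = ennreal \<bar>C\<bar> * (\<Prod>b\<in>Basis. ennreal (k (z \<bullet> b)))" for z
    using k0 by (simp add: Basis_complex_def ennreal_mult i_squared complex_eq_iff)
  have "(\<integral>\<^sup>+ z. ennreal (norm (f z)) \<partial>lborel)
      \<le> (\<integral>\<^sup>+ (z::complex). ennreal \<bar>C\<bar> * (\<Prod>b\<in>Basis. ennreal (k (z \<bullet> b))) \<partial>lborel)"
  proof (rule nn_integral_mono)
    fix z :: complex
    have "norm (f z) \<le> C * (k (Re z) * k (Im z))"
      using bound[of z] by (simp add: k_def divide_inverse)
    also have "\<dots> \<le> \<bar>C\<bar> * (k (Re z) * k (Im z))"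
      using k0 by (intro mult_right_mono) auto
    finally show "ennreal (norm (f z)) \<le> ennreal \<bar>C\<bar> * (\<Prod>b\<in>Basis. ennreal (k (z \<bullet> b)))"
      unfolding prod[symmetric] by (rule ennreal_leI)
  qed
  also have "\<dots> = ennreal \<bar>C\<bar> * (\<Prod>b\<in>(Basis :: complex set). \<integral>\<^sup>+ x. ennreal (k x) \<partial>lborel)"
    using nn_integral_lborel_prod[of "\<lambda>(_ :: complex) x. ennreal (k x)"] by (simp add: nn_integral_cmult)
  also have "\<dots> < \<infinity>"
    using fin by (simp add: ennreal_mult_less_top power_less_top_ennreal)
  finally show ?thesis
    by (intro integrableI_bounded) auto
qed

text \<open>Both shifts cannot be small at once because \<open>A \<noteq> B\<close>, and for large
  \<open>w\<close> each grows like \<open>w\<close>. The triangle inequality turns this into an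
  explicit constant.\<close>

lemma norm_shifts_lower_bound:
  fixes A B :: "'a :: real_normed_vector" and k :: real
  assumes "A \<noteq> B" "k > 0"
  shows "\<exists>c>0. \<forall>w. c * (1 + (norm w)\<^sup>2) \<le> (norm (w + B))\<^sup>2 + k * (norm (w + A))\<^sup>2"
proof -
  define \<delta> where "\<delta> = (norm (A - B))\<^sup>2 / 2"
  have \<delta>: "\<delta> > 0" using assms by (simp add: \<delta>_def)
  \<comment> \<open>For the sum \<open>S\<close> of the squared norms of the two shifts, \<open>1 +
    (norm w)\<^sup>2 \<le> 2 * S + (1 + 2 * (norm B)\<^sup>2)\<close>. The constant is absorbed by
    \<open>1 \<le> S / \<delta>\<close>, which gives \<open>L * S\<close>.\<close>
  define L where "L = 2 + (1 + 2 * (norm B)\<^sup>2) / \<delta>"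
  have L: "L > 0" using \<delta> by (auto simp: L_def intro!: add_pos_nonneg divide_nonneg_pos)
  have sq: "(norm (x - y))\<^sup>2 \<le> 2 * (norm x)\<^sup>2 + 2 * (norm y)\<^sup>2" for x y :: 'a
  proof -
    have "(norm (x - y))\<^sup>2 \<le> (norm x + norm y)\<^sup>2"
      by (intro power_mono norm_triangle_ineq4) auto
    also have "\<dots> \<le> 2 * (norm x)\<^sup>2 + 2 * (norm y)\<^sup>2"
      using zero_le_power2[of "norm x - norm y"] by (simp add: power2_eq_square algebra_simps)
    finally show ?thesis .
  qed
  have "min 1 k / L * (1 + (norm w)\<^sup>2) \<le> (norm (w + B))\<^sup>2 + k * (norm (w + A))\<^sup>2" for w
  proof -
    define S where "S = (norm (w + B))\<^sup>2 + (norm (w + A))\<^sup>2"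
    have S\<delta>: "1 \<le> S / \<delta>"
      using sq[of "w + A" "w + B"] \<delta> by (simp add: S_def \<delta>_def)
    have "(norm w)\<^sup>2 \<le> 2 * (norm (w + B))\<^sup>2 + 2 * (norm B)\<^sup>2"
      using sq[of "w + B" B] by simp
    also have "\<dots> \<le> 2 * S + 2 * (norm B)\<^sup>2"
      by (simp add: S_def)
    finally have "1 + (norm w)\<^sup>2 \<le> 2 * S + (1 + 2 * (norm B)\<^sup>2) * 1" by simp
    also have "\<dots> \<le> 2 * S + (1 + 2 * (norm B)\<^sup>2) * (S / \<delta>)"
      using S\<delta> by (intro add_left_mono mult_left_mono) auto
    also have "\<dots> = L * S" by (simp add: L_def algebra_simps add_divide_distrib)
    finally have "(1 + (norm w)\<^sup>2) / L \<le> S" using L by (simp add: field_simps)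
    then have "min 1 k * ((1 + (norm w)\<^sup>2) / L) \<le> min 1 k * S"
      using assms by (intro mult_left_mono) auto
    also have "\<dots> \<le> (norm (w + B))\<^sup>2 + k * (norm (w + A))\<^sup>2"
      unfolding S_def distrib_left by (intro add_mono mult_right_mono mult_left_le_one_le) (use assms in auto)
    finally show ?thesis by simp
  qed
  then show ?thesis
    using L assms by (intro exI[of _ "min 1 k / L"]) auto
qed

section \<open>Real primitives of the rational forms\<close>

text \<open>This is the real part of a local logarithm; taking the modulus avoids any branch
  cut.\<close>

lemma has_derivative_ln_cmod:
  assumes "z \<noteq> c"
  shows "((\<lambda>z. ln (cmod (z - c))) has_derivative (\<lambda>d. Re (d / (z - c)))) (at z)"
proof -
  have "Re (d / u) = (d \<bullet> sgn u) / cmod u" for d u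
    by (simp add: sgn_div_norm inner_complex_def Re_divide cmod_power2[symmetric])
       (simp add: power2_eq_square field_simps add_divide_distrib)
  moreover have "((\<lambda>z. ln (cmod (z - c))) has_derivative (\<lambda>d. (d \<bullet> sgn (z - c)) / cmod (z - c))) (at z)"
  proof -
    have "((\<lambda>z. cmod (z - c)) has_derivative (\<lambda>d. d \<bullet> sgn (z - c))) (at z)"
    proof (rule has_derivative_compose[where f = "\<lambda>z. z - c"])
      show "((\<lambda>z. z - c) has_derivative (\<lambda>d. d)) (at z)"
        by (auto intro!: derivative_eq_intros)
      show "(cmod has_derivative (\<lambda>d. d \<bullet> sgn (z - c))) (at (z - c))"
        using has_derivative_norm[of "z - c"] assms by simp
    qed
    from DERIV_compose_FDERIV[OF DERIV_ln_divide this] assms show ?thesis by simp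
  qed
  ultimately show ?thesis by simp
qed

text \<open>
  If \<open>c1 + c2 / 2\<close> is purely imaginary, this is the real part of an antiderivative of
  \<open>c0 + c1 / (z\<^sup>2 + 1) + c2 / (z\<^sup>2 + 1)\<^sup>2\<close>: since \<open>(z / (z\<^sup>2 + 1))' = 2 / (z\<^sup>2 + 1)\<^sup>2 - 1 / (z\<^sup>2 + 1)\<close>,
  only \<open>(c1 + c2 / 2) / (z\<^sup>2 + 1)\<close> contributes a logarithm, and its real part is single-valued.
\<close>

definition real_primitive :: "complex \<Rightarrow> complex \<Rightarrow> complex \<Rightarrow> complex \<Rightarrow> real" where
  "real_primitive c0 c1 c2 z = Re (c0 * z + c2 / 2 * (z / (z\<^sup>2 + 1)))
     + Im (c1 + c2 / 2) / 2 * (ln (cmod (z - \<i>)) - ln (cmod (z - (- \<i>))))"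

lemma square_plus_1_eq_0_iff: "z\<^sup>2 + 1 = 0 \<longleftrightarrow> z = \<i> \<or> z = - \<i>" for z :: complex
proof -
  have "z\<^sup>2 + 1 = (z - \<i>) * (z + \<i>)" by (simp add: algebra_simps power2_eq_square)
  then show ?thesis by (auto simp: eq_neg_iff_add_eq_0)
qed

lemma real_primitive_has_derivative:
  assumes "Re (c1 + c2 / 2) = 0" "z \<noteq> \<i>" "z \<noteq> - \<i>"
  shows "(real_primitive c0 c1 c2 has_derivative
          (\<lambda>d. Re (d * (c0 + c1 / (z\<^sup>2 + 1) + c2 / (z\<^sup>2 + 1)\<^sup>2)))) (at z)"
proof -
  have w: "z\<^sup>2 + 1 \<noteq> 0" using assms by (simp add: square_plus_1_eq_0_iff)
  \<comment> \<open>By partial fractions, \<open>\<i> * \<kappa> / (z\<^sup>2 + 1)\<close> is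
    \<open>\<kappa> / 2\<close> times the difference of \<open>1 / (z - \<i>)\<close> and
    \<open>1 / (z + \<i>)\<close>. As \<open>\<kappa>\<close> is real, the real part integrates to
    logarithms of moduli.\<close>
  define \<kappa> where "\<kappa> = Im (c1 + c2 / 2)"
  have \<kappa>: "\<i> * of_real \<kappa> = c1 + c2 / 2" using assms(1) by (simp add: \<kappa>_def complex_eq_iff)
  have "((\<lambda>z. c0 * z + c2 / 2 * (z / (z\<^sup>2 + 1))) has_field_derivative
      c0 + c2 / 2 * ((z\<^sup>2 + 1 - z * (2 * z)) / (z\<^sup>2 + 1)\<^sup>2)) (at z)"
  proof -
    have "((\<lambda>z. z / (z\<^sup>2 + 1)) has_field_derivative
        (z\<^sup>2 + 1 - z * (2 * z)) / (z\<^sup>2 + 1)\<^sup>2) (at z)"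
      using w by (auto intro!: derivative_eq_intros simp: power2_eq_square)
    from DERIV_add[OF DERIV_cmult_Id DERIV_cmult[OF this]] show ?thesis .
  qed
  from bounded_linear.has_derivative[OF bounded_linear_Re this[unfolded has_field_derivative_def]]
  have 1: "((\<lambda>z. Re (c0 * z + c2 / 2 * (z / (z\<^sup>2 + 1)))) has_derivative
      (\<lambda>d. Re (d * (c0 + c2 / 2 * ((z\<^sup>2 + 1 - z * (2 * z)) / (z\<^sup>2 + 1)\<^sup>2))))) (at z)"
    by (simp add: mult.commute del: times_complex.sel plus_complex.sel)
  have 2: "((\<lambda>z. \<kappa> / 2 * (ln (cmod (z - \<i>)) - ln (cmod (z - (- \<i>))))) has_derivative
      (\<lambda>d. \<kappa> / 2 * (Re (d / (z - \<i>)) - Re (d / (z - (- \<i>)))))) (at z)"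
    by (intro has_derivative_mult_right has_derivative_diff has_derivative_ln_cmod assms)
  have log: "\<kappa> / 2 * (Re (d / (z - \<i>)) - Re (d / (z - (- \<i>)))) = Re (d * (c1 + c2 / 2) / (z\<^sup>2 + 1))" for d
  proof -
    have "d / (z - \<i>) - d / (z - (- \<i>)) = d * (2 * \<i>) / (z\<^sup>2 + 1)"
      using w assms by (simp add: field_simps eq_neg_iff_add_eq_0) (simp add: power2_eq_square algebra_simps)
    then have "of_real (\<kappa> / 2) * (d / (z - \<i>) - d / (z - (- \<i>))) = d * (c1 + c2 / 2) / (z\<^sup>2 + 1)"
      by (simp flip: \<kappa>)
    from arg_cong[OF this, of Re] show ?thesis
      by (simp only: scaleR_conv_of_real[symmetric] scaleR_complex.sel minus_complex.sel)
  qed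
  have "c0 + c2 / 2 * ((z\<^sup>2 + 1 - z * (2 * z)) / (z\<^sup>2 + 1)\<^sup>2) + (c1 + c2 / 2) / (z\<^sup>2 + 1)
      = c0 + c1 / (z\<^sup>2 + 1) + c2 / (z\<^sup>2 + 1)\<^sup>2"
  proof -
    have "u + 1 \<noteq> 0 \<Longrightarrow> (u + 1 - 2 * u) / (u + 1)\<^sup>2 = 2 / (u + 1)\<^sup>2 - 1 / (u + 1)" for u :: complex
      by (simp add: divide_simps) (simp add: power2_eq_square algebra_simps)
    from this[of "z\<^sup>2"] w
    have "(z\<^sup>2 + 1 - z * (2 * z)) / (z\<^sup>2 + 1)\<^sup>2 = 2 / (z\<^sup>2 + 1)\<^sup>2 - 1 / (z\<^sup>2 + 1)"
      by (simp add: power2_eq_square algebra_simps)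
    then have "c0 + c2 / 2 * ((z\<^sup>2 + 1 - z * (2 * z)) / (z\<^sup>2 + 1)\<^sup>2) + (c1 + c2 / 2) / (z\<^sup>2 + 1)
        = c0 + c2 / 2 * (2 / (z\<^sup>2 + 1)\<^sup>2 - 1 / (z\<^sup>2 + 1)) + (c1 + c2 / 2) / (z\<^sup>2 + 1)"
      by (simp only:)
    then show ?thesis by (simp add: right_diff_distrib add_divide_distrib)
  qed
  then have "Re (d * (c0 + c2 / 2 * ((z\<^sup>2 + 1 - z * (2 * z)) / (z\<^sup>2 + 1)\<^sup>2))) + Re (d * (c1 + c2 / 2) / (z\<^sup>2 + 1))
      = Re (d * (c0 + c1 / (z\<^sup>2 + 1) + c2 / (z\<^sup>2 + 1)\<^sup>2))" for d
    by (metis distrib_left plus_complex.sel(1) times_divide_eq_right)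
  with has_derivative_add[OF 1 2] show ?thesis
    unfolding real_primitive_def[abs_def] \<kappa>_def[symmetric] log by simp
qed

lemma eventually_square_neq: "\<forall>\<^sub>F w in at z. w\<^sup>2 \<noteq> (c :: complex)"
proof -
  have "finite {w. w\<^sup>2 = c}"
  proof (rule finite_subset)
    show "{w. w\<^sup>2 = c} \<subseteq> {csqrt c, - csqrt c}"
      using power2_eq_iff[of _ "csqrt c"] by auto
  qed simp
  then have "open (- ({w. w\<^sup>2 = c} - {z}))"
    by (intro open_Compl finite_imp_closed) auto
  from eventually_at_in_open[OF this, of z] show ?thesis
    by (auto elim: eventually_mono)
qed

subsection \<open>The surface with two exceptional values\<close>

locale gauss_example =
  fixes a t :: real and \<sigma> :: complex
  assumes nondegenerate: "(a - 1) * (t - 1) \<noteq> 0"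
    and denom_nonzero: "a * ((t - 1) * a + 4) \<noteq> 0"
    and quotient_neg: "(t + 3) / (a * ((t - 1) * a + 4)) < 0"
    and sigma_square: "\<sigma>\<^sup>2 = of_real ((t + 3) / (a * ((t - 1) * a + 4)))"
begin

definition M :: "complex set" where "M = UNIV - {\<i>, - \<i>}"

definition g :: "complex \<Rightarrow> complex" where
  "g z = \<sigma> * ((z\<^sup>2 + 1 + of_real a * (of_real t - 1)) / (z\<^sup>2 + of_real t))"

definition h :: "complex \<Rightarrow> complex" where
  "h z = (z\<^sup>2 + of_real t)\<^sup>2 / (z\<^sup>2 + 1)\<^sup>2"

definition p :: "complex \<Rightarrow> complex" where
  "p z = (z\<^sup>2 + of_real t) / (z\<^sup>2 + 1)"

definition q :: "complex \<Rightarrow> complex" where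
  "q z = \<sigma> * (z\<^sup>2 + 1 + of_real a * (of_real t - 1)) / (z\<^sup>2 + 1)"

definition A :: real where "A = a * (t - 1)"

definition B :: real where "B = t - 1"

text \<open>The coefficients come from expanding the three components of
  \<open>spinor_form (p z) (q z)\<close> in powers of \<open>1 / (z\<^sup>2 + 1)\<close>.\<close>

definition F :: "complex \<Rightarrow> real^3" where
  "F z = vector
    [real_primitive ((1 - \<sigma>\<^sup>2) / 2) (of_real B - \<sigma>\<^sup>2 * of_real A)
       (((of_real B)\<^sup>2 - \<sigma>\<^sup>2 * (of_real A)\<^sup>2) / 2) z,
     real_primitive (\<i> * (1 + \<sigma>\<^sup>2) / 2) (\<i> * (of_real B + \<sigma>\<^sup>2 * of_real A))
       (\<i> * ((of_real B)\<^sup>2 + \<sigma>\<^sup>2 * (of_real A)\<^sup>2) / 2) z,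
     real_primitive \<sigma> (\<sigma> * of_real (A + B)) (\<sigma> * of_real (A * B)) z]"

section \<open>Regularity and vanishing of the real periods\<close>

lemma sigma_nonzero: "\<sigma> \<noteq> 0"
proof
  assume "\<sigma> = 0"
  then have "complex_of_real ((t + 3) / (a * ((t - 1) * a + 4))) = 0" using sigma_square by simp
  then show False using quotient_neg unfolding of_real_eq_0_iff by linarith
qed

text \<open>A square root of a negative real number is purely imaginary. This removes the real
  period of the third form.\<close>

lemma Re_sigma: "Re \<sigma> = 0"
proof -
  have "Re (\<sigma>\<^sup>2) < 0" "Im (\<sigma>\<^sup>2) = 0" using sigma_square quotient_neg by simp_all
  then have "(Re \<sigma>)\<^sup>2 < (Im \<sigma>)\<^sup>2" "Re \<sigma> * Im \<sigma> = 0" by (auto simp: power2_eq_square)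
  then show ?thesis using zero_le_power2[of "Re \<sigma>"] by (cases "Im \<sigma> = 0") (auto simp del: zero_le_power2)
qed

lemma A_neq_B: "A \<noteq> B"
  using nondegenerate by (auto simp: A_def B_def)

lemma a_neq_1: "a \<noteq> 1" and t_neq_1: "t \<noteq> 1"
  using nondegenerate by auto

lemma in_M_iff: "z \<in> M \<longleftrightarrow> z\<^sup>2 + 1 \<noteq> 0"
  by (auto simp: M_def square_plus_1_eq_0_iff)

lemma p_eq: "z \<in> M \<Longrightarrow> p z = 1 + of_real B / (z\<^sup>2 + 1)"
  and q_eq: "z \<in> M \<Longrightarrow> q z = \<sigma> * (1 + of_real A / (z\<^sup>2 + 1))"
  by (simp_all add: p_def q_def A_def B_def in_M_iff field_simps)

lemma no_common_zero: "z \<in> M \<Longrightarrow> p z \<noteq> 0 \<or> q z \<noteq> 0"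
proof (rule ccontr)
  assume z: "z \<in> M" and "\<not> (p z \<noteq> 0 \<or> q z \<noteq> 0)"
  then have "1 + of_real B / (z\<^sup>2 + 1) = 0" "1 + of_real A / (z\<^sup>2 + 1) = 0"
    using sigma_nonzero by (simp_all add: p_eq q_eq)
  then have "of_real A / (z\<^sup>2 + 1) = of_real B / (z\<^sup>2 + 1)" by (metis add_left_imp_eq)
  then show False using A_neq_B z by (simp add: in_M_iff)
qed

text \<open>The prescribed value of \<open>\<sigma>\<^sup>2\<close> is the solution of this equation.\<close>

lemma real_period_condition:
  "4 * (of_real B - \<sigma>\<^sup>2 * of_real A) + ((of_real B)\<^sup>2 - \<sigma>\<^sup>2 * (of_real A)\<^sup>2) = 0"
proof -
  \<comment> \<open>The left side is \<open>(t - 1) * (t + 3)\<close>, and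
    \<open>4 * A + A\<^sup>2\<close> is \<open>a * (t - 1) * (a * (t - 1) + 4)\<close>; their ratio
    is the prescribed \<open>\<sigma>\<^sup>2\<close>.\<close>
  have "4 * B + B\<^sup>2 = (t + 3) / (a * ((t - 1) * a + 4)) * (4 * A + A\<^sup>2)"
    using denom_nonzero by (simp add: A_def B_def field_simps) (simp add: power2_eq_square algebra_simps)
  then have "complex_of_real (4 * B + B\<^sup>2) = \<sigma>\<^sup>2 * complex_of_real (4 * A + A\<^sup>2)"
    unfolding sigma_square by (simp only: of_real_mult)
  then show ?thesis by (simp add: algebra_simps)
qed

lemma F_has_derivative:
  assumes "z \<in> M"
  shows "(F has_derivative (\<lambda>d. re_vec (d *s spinor_form (p z) (q z)))) (at z)"
proof -
  have w: "z\<^sup>2 + 1 \<noteq> 0" and z: "z \<noteq> \<i>" "z \<noteq> - \<i>" using assms in_M_iff[of z] by (auto simp: M_def)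
  have real: "Im (\<sigma>\<^sup>2) = 0" using sigma_square by simp
  define u where "u = inverse (z\<^sup>2 + 1)"
  have pu: "p z = 1 + of_real B * u" and qu: "q z = \<sigma> * (1 + of_real A * u)"
    using assms by (simp_all add: p_eq q_eq u_def divide_inverse)
  have du: "c0 + c1 / (z\<^sup>2 + 1) + c2 / (z\<^sup>2 + 1)\<^sup>2 = c0 + c1 * u + c2 * u\<^sup>2" for c0 c1 c2
    by (simp add: u_def divide_inverse power_inverse)
  note D = real_primitive_has_derivative[OF _ z, unfolded du]
  have e1: "spinor_form (p z) (q z) $ 1 = (1 - \<sigma>\<^sup>2) / 2 + (of_real B - \<sigma>\<^sup>2 * of_real A) * u
      + ((of_real B)\<^sup>2 - \<sigma>\<^sup>2 * (of_real A)\<^sup>2) / 2 * u\<^sup>2"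
    by (simp add: spinor_form_def pu qu power2_eq_square algebra_simps add_divide_distrib diff_divide_distrib)
  have e2: "spinor_form (p z) (q z) $ 2 = \<i> * (1 + \<sigma>\<^sup>2) / 2 + \<i> * (of_real B + \<sigma>\<^sup>2 * of_real A) * u
      + \<i> * ((of_real B)\<^sup>2 + \<sigma>\<^sup>2 * (of_real A)\<^sup>2) / 2 * u\<^sup>2"
    by (simp add: spinor_form_def pu qu power2_eq_square algebra_simps add_divide_distrib diff_divide_distrib)
  have e3: "spinor_form (p z) (q z) $ 3 = \<sigma> + \<sigma> * of_real (A + B) * u + \<sigma> * of_real (A * B) * u\<^sup>2"
    by (simp add: spinor_form_def pu qu power2_eq_square algebra_simps)
  \<comment> \<open>The logarithmic coefficients have zero real part for three different reasons:
    the period equation, \<open>\<sigma>\<^sup>2\<close> being real, and \<open>\<sigma>\<close>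
    being imaginary.\<close>
  have "of_real B - \<sigma>\<^sup>2 * of_real A + ((of_real B)\<^sup>2 - \<sigma>\<^sup>2 * (of_real A)\<^sup>2) / 2 / 2 = 0"
    using real_period_condition by (simp add: field_simps)
  then have r1: "Re (of_real B - \<sigma>\<^sup>2 * of_real A + ((of_real B)\<^sup>2 - \<sigma>\<^sup>2 * (of_real A)\<^sup>2) / 2 / 2) = 0"
    by (simp only: zero_complex.sel)
  have r2: "Re (\<i> * (of_real B + \<sigma>\<^sup>2 * of_real A) + \<i> * ((of_real B)\<^sup>2 + \<sigma>\<^sup>2 * (of_real A)\<^sup>2) / 2 / 2) = 0"
    using real by (simp flip: of_real_power)
  have r3: "Re (\<sigma> * of_real (A + B) + \<sigma> * of_real (A * B) / 2) = 0"
    using Re_sigma by simp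
  have "((\<lambda>z. F z $ i) has_derivative (\<lambda>d. Re (d * spinor_form (p z) (q z) $ i))) (at z)" for i
  proof -
    consider "i = 1" | "i = 2" | "i = 3" using exhaust_3 by blast
    then show ?thesis
    proof cases
      case 1
      then show ?thesis using D[OF r1] unfolding 1 e1 F_def vector_3 by blast
    next
      case 2
      then show ?thesis using D[OF r2] unfolding 2 e2 F_def vector_3 by blast
    next
      case 3
      then show ?thesis using D[OF r3] unfolding 3 e3 F_def vector_3 by blast
    qed
  qed
  then show ?thesis
    by (subst has_derivative_componentwise_within)
      (auto simp: Basis_vec_def inner_axis simp del: times_complex.sel)
qed

lemma open_M: "open M"
  unfolding M_def by (intro open_Diff) auto

lemma connected_M: "connected M"
  unfolding M_def using connected_open_delete_finite[of "UNIV :: complex set" "{\<i>, - \<i>}"] by (simp add: connected_UNIV)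

sublocale ws: weierstrass_spinor M p q g h F
proof
  show "p holomorphic_on M" "q holomorphic_on M"
    unfolding p_def q_def by (auto intro!: holomorphic_intros simp: in_M_iff)
  \<comment> \<open>Points with \<open>w\<^sup>2 = - 1\<close> are excluded as well, because
    division by zero makes \<open>p\<close> vanish there.\<close>
  show "\<forall>\<^sub>F w in at z. p w \<noteq> 0" if "z \<in> M" for z
    using eventually_square_neq[of "- of_real t" z] eventually_square_neq[of "- 1" z]
    by eventually_elim (auto simp: p_def eq_neg_iff_add_eq_0)
  show "h z = (p z)\<^sup>2" for z
    by (simp add: h_def p_def power_divide)
  show "g z = q z / p z" if "z \<in> M" for z
    using that by (simp add: g_def p_def q_def in_M_iff)
qed (use open_M connected_M no_common_zero F_has_derivative in blast)+

text \<open>The partial fraction form shows \<open>g\<close> as a Moebius transformation of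
  \<open>z\<^sup>2\<close> that tends to \<open>\<sigma>\<close> at infinity.\<close>

lemma g_eq_add: "z\<^sup>2 + of_real t \<noteq> 0 \<Longrightarrow> g z = \<sigma> * (1 + of_real (A - B) / (z\<^sup>2 + of_real t))"
  by (simp add: g_def A_def B_def field_simps)

lemma weierstrass_data_example: "weierstrass_data M h g"
proof (rule ws.weierstrass_dataI)
  show "g meromorphic_on M"
    unfolding g_def by (intro meromorphic_intros)
  show "\<not> g constant_on M"
  proof
    assume "g constant_on M"
    then obtain c where c: "\<And>z. z \<in> M \<Longrightarrow> g z = c" by (auto simp: constant_on_def)
    \<comment> \<open>If \<open>g\<close> were constantly \<open>c\<close>, then \<open>c\<close>
      would determine \<open>x\<^sup>2 + t\<close> for all large real \<open>x\<close>. The bound on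
      \<open>x\<close> keeps \<open>x\<^sup>2 + t\<close> positive, away from the poles; two values
      of \<open>x\<close> then contradict each other.\<close>
    have g_real: "of_real (x\<^sup>2 + t) = of_real (A - B) * \<sigma> / (c - \<sigma>) \<and> c \<noteq> \<sigma>" if "x \<ge> 1 + \<bar>t\<bar>" for x
    proof -
      have "x \<le> x\<^sup>2" using that by (simp add: self_le_power)
      then have pos: "x\<^sup>2 + t > 0" "x\<^sup>2 + 1 > 0" using that by linarith+
      have w: "(of_real x)\<^sup>2 + of_real t = complex_of_real (x\<^sup>2 + t)"
        "(of_real x)\<^sup>2 + 1 = complex_of_real (x\<^sup>2 + 1)"
        by simp_all
      have "complex_of_real x \<in> M"
        unfolding in_M_iff w of_real_eq_0_iff using pos by simp
      moreover have nz: "complex_of_real (x\<^sup>2 + t) \<noteq> 0"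
        unfolding of_real_eq_0_iff using pos by simp
      ultimately have "c = \<sigma> * (1 + of_real (A - B) / of_real (x\<^sup>2 + t))"
        using c g_eq_add[of "of_real x"] unfolding w by metis
      then have eq: "(c - \<sigma>) * of_real (x\<^sup>2 + t) = of_real (A - B) * \<sigma>"
        using nz by (simp add: field_simps del: of_real_add of_real_power of_real_diff)
      moreover have "of_real (A - B) * \<sigma> \<noteq> 0"
        using A_neq_B sigma_nonzero by simp
      ultimately have "c - \<sigma> \<noteq> 0" by (metis mult_zero_left)
      then show ?thesis
        using eq by (simp add: eq_divide_eq mult.commute del: of_real_add of_real_power of_real_diff)
    qed
    have "complex_of_real ((1 + \<bar>t\<bar>)\<^sup>2 + t) = of_real ((2 + \<bar>t\<bar>)\<^sup>2 + t)"
      using g_real[of "1 + \<bar>t\<bar>"] g_real[of "2 + \<bar>t\<bar>"]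
      by (simp del: of_real_add of_real_power of_real_diff)
    then have "(1 + \<bar>t\<bar>)\<^sup>2 = (2 + \<bar>t\<bar>)\<^sup>2"
      unfolding of_real_eq_iff by simp
    then show False by (simp add: power2_eq_square algebra_simps)
  qed
qed

section \<open>Metric estimates and completeness\<close>

lemma cmod_square_p_q:
  "(cmod (p z))\<^sup>2 + (cmod (q z))\<^sup>2
    = ((cmod (z\<^sup>2 + 1 + of_real B))\<^sup>2 + (cmod \<sigma>)\<^sup>2 * (cmod (z\<^sup>2 + 1 + of_real A))\<^sup>2) / (cmod (z\<^sup>2 + 1))\<^sup>2"
proof -
  have "z\<^sup>2 + 1 + of_real B = z\<^sup>2 + of_real t" by (simp add: B_def)
  then have "(cmod (p z))\<^sup>2 = (cmod (z\<^sup>2 + 1 + of_real B))\<^sup>2 / (cmod (z\<^sup>2 + 1))\<^sup>2"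
    by (simp only: p_def norm_divide power_divide)
  moreover have "(cmod (q z))\<^sup>2
      = (cmod \<sigma>)\<^sup>2 * (cmod (z\<^sup>2 + 1 + of_real A))\<^sup>2 / (cmod (z\<^sup>2 + 1))\<^sup>2"
    by (simp add: q_def A_def norm_divide norm_mult power_divide power_mult_distrib)
  ultimately show ?thesis by (simp only: add_divide_distrib)
qed

lemma shifts_lower_bound:
  "\<exists>c>0. \<forall>w. c * (1 + (cmod w)\<^sup>2) \<le> (cmod (w + of_real B))\<^sup>2 + (cmod \<sigma>)\<^sup>2 * (cmod (w + of_real A))\<^sup>2"
  by (rule norm_shifts_lower_bound) (use A_neq_B sigma_nonzero in auto)

text \<open>Both \<open>p\<close> and \<open>q\<close> are affine in
  \<open>u = 1 / (z\<^sup>2 + 1)\<close>, so the Wronskian is a constant multiple of the derivative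
  of \<open>u\<close>.\<close>

lemma wronskian_eq:
  assumes "z \<in> M"
  shows "deriv p z * q z - p z * deriv q z = 2 * z * \<sigma> * of_real (A - B) / (z\<^sup>2 + 1)\<^sup>2"
proof -
  have w: "z\<^sup>2 + 1 \<noteq> 0" using assms by (simp add: in_M_iff)
  have quot: "((\<lambda>z. c * (z\<^sup>2 + 1 + d) / (z\<^sup>2 + 1)) has_field_derivative - (2 * z * c * d) / (z\<^sup>2 + 1)\<^sup>2) (at z)" for c d
    using w by (auto intro!: derivative_eq_intros) (simp add: power2_eq_square algebra_simps)
  have pq: "p = (\<lambda>z. 1 * (z\<^sup>2 + 1 + of_real B) / (z\<^sup>2 + 1))" "q = (\<lambda>z. \<sigma> * (z\<^sup>2 + 1 + of_real A) / (z\<^sup>2 + 1))"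
    by (simp_all add: fun_eq_iff p_def q_def A_def B_def)
  have d: "deriv p z = - (2 * z * 1 * of_real B) / (z\<^sup>2 + 1)\<^sup>2" "deriv q z = - (2 * z * \<sigma> * of_real A) / (z\<^sup>2 + 1)\<^sup>2"
    unfolding pq by (rule DERIV_imp_deriv[OF quot])+
  define u where "u = inverse (z\<^sup>2 + 1)"
  show ?thesis
    unfolding d p_eq[OF assms] q_eq[OF assms] divide_inverse power_inverse[symmetric] u_def[symmetric]
    by (simp add: power2_eq_square algebra_simps)
qed

lemma complete_example:
  assumes "z0 \<in> M"
  shows "complete_surface M (weierstrass_immersion M z0 h g)"
proof -
  interpret S: spinor_immersion M p q "weierstrass_immersion M z0 h g"
    by (rule ws.spinor_immersion_weierstrass[OF assms])
  obtain c where c: "c > 0"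
    "\<And>w. c * (1 + (cmod w)\<^sup>2) \<le> (cmod (w + of_real B))\<^sup>2 + (cmod \<sigma>)\<^sup>2 * (cmod (w + of_real A))\<^sup>2"
    using shifts_lower_bound by blast
  \<comment> \<open>Dividing the bound for shifts by \<open>(cmod (z\<^sup>2 + 1))\<^sup>2\<close>
    controls the metric from below both at infinity and at the punctures \<open>\<i>\<close> and
    \<open>- \<i>\<close>.\<close>
  have weight: "1 + 1 / (cmod (z\<^sup>2 + 1))\<^sup>2 \<le> S.weight z / c" if "z \<in> M" for z
  proof -
    define r where "r = (cmod (z\<^sup>2 + 1))\<^sup>2"
    have r: "r > 0" using that by (simp add: in_M_iff r_def)
    have "c * (1 + r) / r \<le> S.weight z"
      using c(2)[of "z\<^sup>2 + 1"] r unfolding S.weight_def cmod_square_p_q r_def[symmetric]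
      by (intro divide_right_mono) auto
    then have "c * (1 + r) / r / c \<le> S.weight z / c"
      using c(1) by (intro divide_right_mono) auto
    moreover have "1 + 1 / r = c * (1 + r) / r / c"
      using r c(1) by (simp add: field_simps)
    ultimately show ?thesis
      unfolding r_def[symmetric] by linarith
  qed
  let ?f = "\<lambda>z :: complex. z / (z\<^sup>2 + 1)"
  show ?thesis
  \<comment> \<open>The identity detects escape to infinity, \<open>?f\<close> escape to a puncture.
    The 3 comes from \<open>2 * r\<^sup>2 + r \<le> 3 * (1 + r\<^sup>2)\<close>, where
    \<open>r = 1 / cmod (z\<^sup>2 + 1)\<close>.\<close>
  proof (rule S.complete_surfaceI[where F = "{\<lambda>z. z, ?f}" and C = "3 / c"])
    fix f assume "f \<in> {\<lambda>z. z, ?f}"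
    then show "f holomorphic_on M"
      by (auto intro!: holomorphic_intros simp: in_M_iff)
  next
    fix f z assume f: "f \<in> {\<lambda>z. z, ?f}" and z: "z \<in> M"
    define r where "r = 1 / cmod (z\<^sup>2 + 1)"
    have w: "z\<^sup>2 + 1 \<noteq> 0" using z by (simp add: in_M_iff)
    have "(?f has_field_derivative 2 / (z\<^sup>2 + 1)\<^sup>2 - 1 / (z\<^sup>2 + 1)) (at z)"
      using w by (auto intro!: derivative_eq_intros simp: divide_simps) (simp add: power2_eq_square algebra_simps)
    then have "cmod (deriv ?f z) \<le> cmod (2 / (z\<^sup>2 + 1)\<^sup>2) + cmod (1 / (z\<^sup>2 + 1))"
      by (simp add: DERIV_imp_deriv norm_triangle_ineq4)
    also have "\<dots> = 2 * r\<^sup>2 + r"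
      by (simp add: norm_divide norm_power r_def power_divide)
    also have "\<dots> \<le> 3 * (1 + r\<^sup>2)"
    proof -
      have "2 * r \<le> r\<^sup>2 + 1"
        using zero_le_power2[of "r - 1"] unfolding power2_diff by simp
      moreover have "0 \<le> r" by (simp add: r_def)
      ultimately have "r \<le> r\<^sup>2 + 1" by linarith
      then show ?thesis by (simp add: distrib_left)
    qed
    finally have "cmod (deriv f z) \<le> 3 * (1 + r\<^sup>2)"
      using f by auto
    also have "\<dots> \<le> 3 * (S.weight z / c)"
      using weight[OF z] by (intro mult_left_mono) (simp_all add: r_def power_divide)
    finally show "cmod (deriv f z) \<le> 3 / c * S.weight z" by simp
  next
    fix R :: "(complex \<Rightarrow> complex) \<Rightarrow> real"
    \<comment> \<open>Written without division, the second condition is closed in the whole plane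
      and fails at \<open>\<i>\<close> and \<open>- \<i>\<close>, where its right side is 0.\<close>
    define K where "K = {z. cmod z \<le> R (\<lambda>z. z) \<and> cmod z \<le> R ?f * cmod (z\<^sup>2 + 1)}"
    have "closed K"
      unfolding K_def by (intro closed_Collect_conj closed_Collect_le continuous_intros)
    moreover have "K \<subseteq> cball 0 (R (\<lambda>z. z))"
      by (auto simp: K_def)
    ultimately have "compact K"
      by (meson bounded_cball bounded_subset compact_eq_bounded_closed)
    moreover have "K \<subseteq> M"
      by (auto simp: K_def M_def)
    moreover have "{z \<in> M. \<forall>f\<in>{\<lambda>z. z, ?f}. cmod (f z) \<le> R f} \<subseteq> K"
      by (auto simp: K_def in_M_iff norm_divide divide_le_eq)
    ultimately show "\<exists>K. compact K \<and> K \<subseteq> M \<and> {z \<in> M. \<forall>f\<in>{\<lambda>z. z, ?f}. cmod (f z) \<le> R f} \<subseteq> K"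
      by blast
  qed
qed

section \<open>Finite total curvature\<close>

lemma finite_total_curvature_example:
  assumes "z0 \<in> M"
  shows "finite_total_curvature M (weierstrass_immersion M z0 h g)"
proof -
  interpret S: spinor_immersion M p q "weierstrass_immersion M z0 h g"
    by (rule ws.spinor_immersion_weierstrass[OF assms])
  define D where "D z = (cmod (z\<^sup>2 + 1 + of_real B))\<^sup>2 + (cmod \<sigma>)\<^sup>2 * (cmod (z\<^sup>2 + 1 + of_real A))\<^sup>2" for z
  obtain c where c: "c > 0"
    "\<And>w. c * (1 + (cmod w)\<^sup>2) \<le> (cmod (w + of_real B))\<^sup>2 + (cmod \<sigma>)\<^sup>2 * (cmod (w + of_real A))\<^sup>2"
    using shifts_lower_bound by blast
  \<comment> \<open>Inserting the Wronskian into the curvature density cancels all powers of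
    \<open>z\<^sup>2 + 1\<close>. The resulting \<open>f\<close> is continuous even at the
    punctures.\<close>
  define k where "k = - 16 * (cmod \<sigma>)\<^sup>2 * (A - B)\<^sup>2"
  define f where "f z = k * (cmod z)\<^sup>2 / (D z)\<^sup>2" for z
  have D: "c / 3 * (1 + (cmod z) ^ 4) \<le> D z" for z
  proof -
    have "(cmod z)\<^sup>2 \<le> cmod (z\<^sup>2 + 1) + 1"
      using norm_triangle_ineq4[of "z\<^sup>2 + 1" 1] by (simp add: norm_power)
    then have "((cmod z)\<^sup>2)\<^sup>2 \<le> (cmod (z\<^sup>2 + 1) + 1)\<^sup>2"
      by (intro power_mono) auto
    also have "\<dots> \<le> 2 * (cmod (z\<^sup>2 + 1))\<^sup>2 + 2"
      using zero_le_power2[of "cmod (z\<^sup>2 + 1) - 1"] unfolding power2_diff power2_sum by simp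
    finally have "(cmod z) ^ 4 \<le> 2 * (cmod (z\<^sup>2 + 1))\<^sup>2 + 2" by simp
    also have "\<dots> \<le> 3 * (cmod (z\<^sup>2 + 1))\<^sup>2 + 2" by simp
    finally have "1 + (cmod z) ^ 4 \<le> 3 * (1 + (cmod (z\<^sup>2 + 1))\<^sup>2)" by simp
    then have "c / 3 * (1 + (cmod z) ^ 4) \<le> c * (1 + (cmod (z\<^sup>2 + 1))\<^sup>2)"
      using c(1) by simp
    also have "\<dots> \<le> D z"
      using c(2)[of "z\<^sup>2 + 1"] by (simp add: D_def)
    finally show ?thesis .
  qed
  have D_pos: "D z > 0" for z
    using c(1) by (intro less_le_trans[OF _ D]) (simp add: add_pos_nonneg)
  have "continuous_on UNIV f"
    unfolding f_def using D_pos unfolding D_def by (intro continuous_intros) (auto simp: less_le)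
  then have "f \<in> borel_measurable borel"
    by (rule borel_measurable_continuous_onI)
  \<comment> \<open>Since \<open>D\<close> grows like the fourth power of \<open>cmod z\<close>,
    \<open>f\<close> decays like the inverse sixth power. The 18 is 2 from bounding the product of
    the two factors, times 9 from squaring \<open>c / 3\<close>.\<close>
  moreover have "\<bar>f z\<bar> \<le> 18 * \<bar>k\<bar> / c\<^sup>2 / ((1 + (Re z)\<^sup>2) * (1 + (Im z)\<^sup>2))" for z
  proof -
    define r where "r = (cmod z)\<^sup>2"
    have r: "r \<ge> 0" "r\<^sup>2 = (cmod z) ^ 4" by (simp_all add: r_def)
    have "(1 + (Re z)\<^sup>2) * (1 + (Im z)\<^sup>2) \<le> (1 + r) * (1 + r)"
      by (intro mult_mono) (auto simp: r_def cmod_power2)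
    also have "\<dots> \<le> 2 * (1 + r\<^sup>2)"
      using zero_le_power2[of "r - 1"] by (simp add: power2_eq_square algebra_simps)
    finally have xy: "(1 + (Re z)\<^sup>2) * (1 + (Im z)\<^sup>2) \<le> 2 * (1 + r\<^sup>2)" .
    have "r * ((1 + (Re z)\<^sup>2) * (1 + (Im z)\<^sup>2)) \<le> (1 + r\<^sup>2) * (2 * (1 + r\<^sup>2))"
    proof (rule mult_mono[OF _ xy])
      show "r \<le> 1 + r\<^sup>2"
        using zero_le_power2[of "r - 1"] r(1) by (simp add: power2_eq_square algebra_simps)
    qed (use r in auto)
    also have "\<dots> = 18 / c\<^sup>2 * (c / 3 * (1 + r\<^sup>2))\<^sup>2"
      using c(1) by (simp add: power2_eq_square)
    also have "\<dots> \<le> 18 / c\<^sup>2 * (D z)\<^sup>2"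
      using D[of z] c(1) r by (intro mult_left_mono power_mono) auto
    finally have "r * ((1 + (Re z)\<^sup>2) * (1 + (Im z)\<^sup>2)) \<le> 18 / c\<^sup>2 * (D z)\<^sup>2" .
    moreover have "(1 + (Re z)\<^sup>2) * (1 + (Im z)\<^sup>2) > 0"
      by (intro mult_pos_pos add_pos_nonneg) auto
    ultimately have "r / (D z)\<^sup>2 \<le> 18 / c\<^sup>2 / ((1 + (Re z)\<^sup>2) * (1 + (Im z)\<^sup>2))"
      using D_pos[of z] unfolding pos_le_divide_eq[OF \<open>(1 + (Re z)\<^sup>2) * (1 + (Im z)\<^sup>2) > 0\<close>]
      by (simp only: times_divide_eq_left pos_divide_le_eq zero_less_power)
    from mult_left_mono[OF this, of "\<bar>k\<bar>"] show ?thesis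
      by (simp add: f_def r_def abs_mult mult.commute[of 18])
  qed
  ultimately have "integrable lborel f"
    by (rule integrable_lborel_complex_bound)
  then have "set_integrable lborel M f"
    unfolding set_integrable_def using open_M by (intro integrable_mult_indicator) auto
  moreover have "f z = gauss_curvature (weierstrass_immersion M z0 h g) z *
      sqrt (first_E (weierstrass_immersion M z0 h g) z * first_G (weierstrass_immersion M z0 h g) z
        - (first_F (weierstrass_immersion M z0 h g) z)\<^sup>2)" if "z \<in> M" for z
  proof -
    have "z\<^sup>2 + 1 \<noteq> 0" using that by (simp add: in_M_iff)
    moreover have "cmod (of_real (A - B)) = \<bar>A - B\<bar>" by (rule norm_of_real)
    ultimately show ?thesis
      unfolding S.total_curvature_density[OF that] S.weight_def S.wronskian_def cmod_square_p_q
        wronskian_eq[OF that] D_def[symmetric]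
      using D_pos[of z]
      by (simp add: f_def k_def norm_mult norm_divide norm_power power_mult_distrib power_divide
          del: of_real_diff)
  qed
  ultimately show ?thesis
    unfolding finite_total_curvature_def by (simp cong: set_integrable_cong)
qed

section \<open>Poles and multiplicities of \<open>g\<close>\<close>

lemma is_pole_g:
  assumes "z\<^sup>2 + of_real t = 0"
  shows "is_pole g z"
proof -
  \<comment> \<open>At a zero of the denominator the numerator equals
    \<open>(a - 1) * (t - 1)\<close>, so nothing cancels.\<close>
  have num: "z\<^sup>2 + 1 + of_real a * (of_real t - 1) \<noteq> 0"
  proof -
    have "z\<^sup>2 + 1 + of_real a * (of_real t - 1) = (z\<^sup>2 + of_real t) + of_real ((a - 1) * (t - 1))"
      by (simp add: algebra_simps)
    then show ?thesis using nondegenerate assms by (metis add_0 of_real_eq_0_iff)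
  qed
  have "filterlim (\<lambda>z. z\<^sup>2 + of_real t) (at 0) (at z)"
    unfolding filterlim_at
  proof
    show "\<forall>\<^sub>F w in at z. w\<^sup>2 + of_real t \<in> UNIV \<and> w\<^sup>2 + of_real t \<noteq> 0"
      using eventually_square_neq[of "- of_real t" z] by (simp add: eq_neg_iff_add_eq_0)
    have "((\<lambda>w. w\<^sup>2 + of_real t) \<longlongrightarrow> z\<^sup>2 + of_real t) (at z)"
      by (intro tendsto_intros)
    then show "((\<lambda>w. w\<^sup>2 + of_real t) \<longlongrightarrow> 0) (at z)" using assms by simp
  qed
  then have "is_pole (\<lambda>z. (z\<^sup>2 + 1 + of_real a * (of_real t - 1)) / (z\<^sup>2 + of_real t)) z"
    by (intro is_pole_divide num) auto
  then show ?thesis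
    using sigma_nonzero by (simp only: g_def[abs_def] is_pole_cmult_iff not_False_eq_True)
qed

lemma g_analytic: "z\<^sup>2 + of_real t \<noteq> 0 \<Longrightarrow> g analytic_on {z}"
  unfolding g_def by (intro analytic_intros) auto

lemma sphere_map_g: "sphere_map g z = (if z\<^sup>2 + of_real t = 0 then Infty else Fin (g z))"
  using is_pole_g analytic_at_imp_no_pole[OF g_analytic] g_analytic
  by (auto simp: sphere_map_def)

lemma gauss_map_example:
  assumes "z0 \<in> M" "z \<in> M"
  shows "gauss_map (weierstrass_immersion M z0 h g) z = sphere_map g z"
proof -
  interpret S: spinor_immersion M p q "weierstrass_immersion M z0 h g"
    by (rule ws.spinor_immersion_weierstrass[OF assms(1)])
  have "p z = 0 \<longleftrightarrow> z\<^sup>2 + of_real t = 0"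
    using assms(2) by (simp add: p_def in_M_iff)
  then show ?thesis
    using S.gauss_map_X[OF assms(2)] ws.g_eq[OF assms(2)] by (simp add: sphere_map_g)
qed

text \<open>The factor \<open>(w + z) * (w - z)\<close> gives the order of vanishing at
  \<open>z\<close>: two when \<open>z = 0\<close>, one otherwise. It also shows that
  \<open>g\<close> separates values of \<open>z\<^sup>2\<close>.\<close>

lemma g_diff:
  assumes "z\<^sup>2 + of_real t \<noteq> 0" "w\<^sup>2 + of_real t \<noteq> 0"
  shows "g w - g z = - (\<sigma> * of_real (A - B)) / ((w\<^sup>2 + of_real t) * (z\<^sup>2 + of_real t)) * ((w + z) * (w - z))"
proof -
  have "g w - g z = \<sigma> * of_real (A - B) * (1 / (w\<^sup>2 + of_real t) - 1 / (z\<^sup>2 + of_real t))"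
    unfolding g_eq_add[OF assms(1)] g_eq_add[OF assms(2)]
    by (simp add: algebra_simps diff_divide_distrib)
  also have "1 / (w\<^sup>2 + of_real t) - 1 / (z\<^sup>2 + of_real t)
      = - ((w + z) * (w - z)) / ((w\<^sup>2 + of_real t) * (z\<^sup>2 + of_real t))"
  proof -
    have "z\<^sup>2 + of_real t - (w\<^sup>2 + of_real t) = - ((w + z) * (w - z))"
      by (simp add: power2_eq_square algebra_simps)
    with diff_frac_eq[OF assms(2,1), of 1 1] show ?thesis by (simp only: mult_1 mult_1_right)
  qed
  finally show ?thesis by simp
qed

lemma mult_at_g: "mult_at g z = (if z = 0 then 2 else 1)"
proof (cases "z\<^sup>2 + of_real t = 0")
  case True
  have num: "z\<^sup>2 + 1 + of_real A \<noteq> 0"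
  proof -
    have "z\<^sup>2 + 1 + of_real A = (z\<^sup>2 + of_real t) + of_real (A - B)"
      by (simp add: B_def)
    then show ?thesis using True A_neq_B by (simp del: of_real_diff)
  qed
  have g: "g w = \<sigma> * (w\<^sup>2 + 1 + of_real A) / ((w + z) * (w - z))" for w
  proof -
    have "w\<^sup>2 + of_real t = (w + z) * (w - z) + (z\<^sup>2 + of_real t)"
      by (simp add: power2_eq_square algebra_simps)
    then have "w\<^sup>2 + of_real t = (w + z) * (w - z)" by (simp only: True add_0_right)
    then show ?thesis by (simp add: g_def A_def)
  qed
  have "zorder g z = (if z = 0 then - 2 else - 1)"
  proof (cases "z = 0")
    case True
    have "zorder g z = - 2"
    proof (rule zorder_eqI[of UNIV _ "\<lambda>w. \<sigma> * (w\<^sup>2 + 1 + of_real A)"])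
      fix w assume "w \<noteq> z"
      then show "g w = \<sigma> * (w\<^sup>2 + 1 + of_real A) * (w - z) powi - 2"
        using True by (simp add: g power_int_minus divide_inverse power2_eq_square)
    qed (use num sigma_nonzero in \<open>auto intro!: holomorphic_intros\<close>)
    then show ?thesis using True by simp
  next
    case False
    have "zorder g z = - 1"
    \<comment> \<open>The opposite pole \<open>- z\<close> is removed to keep the cofactor
      holomorphic; it differs from \<open>z\<close> because \<open>z \<noteq> 0\<close>.\<close>
    proof (rule zorder_eqI[of "- {- z}" _ "\<lambda>w. \<sigma> * (w\<^sup>2 + 1 + of_real A) / (w + z)"])
      fix w assume "w \<noteq> z"
      then show "g w = \<sigma> * (w\<^sup>2 + 1 + of_real A) / (w + z) * (w - z) powi - 1"
        by (simp add: g power_int_minus divide_inverse)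
    qed (use num sigma_nonzero False in \<open>auto intro!: holomorphic_intros simp: eq_neg_iff_add_eq_0\<close>)
    then show ?thesis using False by simp
  qed
  then show ?thesis
    using is_pole_g[OF True] by (simp add: mult_at_def)
next
  case False
  have "zorder (\<lambda>w. g w - g z) z = (if z = 0 then 2 else 1)"
  proof (cases "z = 0")
    case True
    let ?k = "\<lambda>w. - (\<sigma> * of_real (A - B)) / ((w\<^sup>2 + of_real t) * (z\<^sup>2 + of_real t))"
    have "zorder (\<lambda>w. g w - g z) z = 2"
    proof (rule zorder_eqI[of "{w. w\<^sup>2 + of_real t \<noteq> 0}" _ ?k])
      show "open {w :: complex. w\<^sup>2 + of_real t \<noteq> 0}"
        by (intro open_Collect_neq continuous_intros)
      show "?k holomorphic_on {w. w\<^sup>2 + of_real t \<noteq> 0}"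
        using False by (intro holomorphic_intros) auto
      show "g w - g z = ?k w * (w - z) powi 2" if "w \<in> {w. w\<^sup>2 + of_real t \<noteq> 0}" for w
        using g_diff[OF False, of w] that True by (simp add: power2_eq_square)
    qed (use False sigma_nonzero A_neq_B in auto)
    then show ?thesis using True by simp
  next
    case z: False
    let ?k = "\<lambda>w. - (\<sigma> * of_real (A - B)) / ((w\<^sup>2 + of_real t) * (z\<^sup>2 + of_real t)) * (w + z)"
    have "zorder (\<lambda>w. g w - g z) z = 1"
    proof (rule zorder_eqI[of "{w. w\<^sup>2 + of_real t \<noteq> 0}" _ ?k])
      show "open {w :: complex. w\<^sup>2 + of_real t \<noteq> 0}"
        by (intro open_Collect_neq continuous_intros)
      show "?k holomorphic_on {w. w\<^sup>2 + of_real t \<noteq> 0}"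
        using False by (intro holomorphic_intros) auto
      show "g w - g z = ?k w * (w - z) powi 1" if "w \<in> {w. w\<^sup>2 + of_real t \<noteq> 0}" for w
        using g_diff[OF False, of w] that by (simp add: mult.assoc)
    qed (use False sigma_nonzero A_neq_B z in auto)
    then show ?thesis using z by simp
  qed
  then show ?thesis
    using analytic_at_imp_no_pole[OF g_analytic[OF False]] g_analytic[OF False]
    by (simp add: mult_at_def)
qed

section \<open>Exceptional and totally ramified values\<close>

text \<open>On \<open>M\<close> the square takes every finite value except -1, so the omitted values
  of \<open>g\<close> are those of the Moebius transformation at infinity and at -1.\<close>

lemma exceptional_values: "{b. exceptional_value M g b} = {Fin \<sigma>, Fin (\<sigma> * of_real a)}"
proof -
  have AB: "A - B = (a - 1) * (t - 1)" by (simp add: A_def B_def algebra_simps)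
  have "fibre M g (Fin \<sigma>) = {}"
    using sigma_nonzero A_neq_B by (auto simp: fibre_def sphere_map_g g_eq_add split: if_splits)
  moreover have "fibre M g (Fin (\<sigma> * of_real a)) = {}"
  proof -
    have False if "z \<in> M" "z\<^sup>2 + of_real t \<noteq> 0" "g z = \<sigma> * of_real a" for z
    proof -
      have "1 + of_real (A - B) / (z\<^sup>2 + of_real t) = of_real a"
        using that g_eq_add[of z] sigma_nonzero by simp
      then have "of_real (A - B) / (z\<^sup>2 + of_real t) = of_real a - 1"
        by (simp only: eq_diff_eq add.commute)
      then have "(of_real a - 1) * (z\<^sup>2 + of_real t) = of_real (A - B)"
        using that(2) by (simp only: divide_eq_eq not_False_eq_True if_True)
      also have "\<dots> = (of_real a - 1) * (of_real t - 1)"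
        unfolding AB by simp
      finally have "z\<^sup>2 + of_real t = of_real t - 1"
        using a_neq_1 by simp
      moreover have "z\<^sup>2 + 1 = (z\<^sup>2 + of_real t) - (of_real t - 1)" by simp
      ultimately have "z\<^sup>2 + 1 = 0" by (simp only: diff_self)
      then show False using that(1) by (simp only: in_M_iff)
    qed
    then show ?thesis by (auto simp: fibre_def sphere_map_g split: if_splits)
  qed
  moreover have "fibre M g Infty \<noteq> {}"
  proof -
    \<comment> \<open>The poles lie in \<open>M\<close> because \<open>t \<noteq> 1\<close>.\<close>
    have "(csqrt (- of_real t))\<^sup>2 + 1 \<noteq> 0"
      using t_neq_1 unfolding power2_csqrt add_eq_0_iff by simp
    then have "csqrt (- of_real t) \<in> fibre M g Infty"
      by (simp add: fibre_def sphere_map_g in_M_iff)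
    then show ?thesis by blast
  qed
  moreover have "fibre M g (Fin c) \<noteq> {}" if c: "c \<noteq> \<sigma>" "c \<noteq> \<sigma> * of_real a" for c
  proof -
    \<comment> \<open>This is the value of \<open>z\<^sup>2 + t\<close> at which
      \<open>g_eq_add\<close> gives \<open>c\<close>; a square root then provides the preimage. It
      could fall on a puncture only if \<open>s = t - 1\<close>, which means
      \<open>c = \<sigma> * a\<close>.\<close>
    define s where "s = \<sigma> * of_real (A - B) / (c - \<sigma>)"
    define z where "z = csqrt (s - of_real t)"
    have z: "z\<^sup>2 + of_real t = s" by (simp add: z_def)
    have s: "s \<noteq> 0" using c A_neq_B sigma_nonzero by (simp add: s_def)
    have "z\<^sup>2 + 1 \<noteq> 0"
    proof
      assume "z\<^sup>2 + 1 = 0"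
      moreover have "s = (z\<^sup>2 + 1) + of_real (t - 1)"
        unfolding z[symmetric] by simp
      ultimately have "s = of_real (t - 1)" by simp
      then have "\<sigma> * of_real (a - 1) * of_real (t - 1) = (c - \<sigma>) * of_real (t - 1)"
        using c unfolding s_def AB by (simp add: divide_eq_eq mult.assoc mult.commute[of "c - \<sigma>"] del: of_real_diff)
      moreover have t: "of_real (t - 1) \<noteq> (0 :: complex)"
        using t_neq_1 unfolding of_real_eq_0_iff by simp
      ultimately have "\<sigma> * of_real (a - 1) = c - \<sigma>"
        using mult_right_cancel[OF t] by blast
      then have "c = \<sigma> * of_real a" by (simp add: right_diff_distrib)
      then show False using c by simp
    qed
    moreover have "g z = c"
    proof -
      have "\<sigma> * of_real (A - B) / s = c - \<sigma>"
        using c A_neq_B sigma_nonzero unfolding s_def by simp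
      then show ?thesis
        using g_eq_add[of z] s unfolding z by (simp add: distrib_left)
    qed
    ultimately have "z \<in> fibre M g (Fin c)"
      using s z by (simp add: fibre_def sphere_map_g in_M_iff)
    then show ?thesis by blast
  qed
  ultimately have "fibre M g b = {} \<longleftrightarrow> b \<in> {Fin \<sigma>, Fin (\<sigma> * of_real a)}" for b
    by (cases b) auto
  then show ?thesis by (simp only: exceptional_value_def Collect_mem_eq)
qed

text \<open>For \<open>t = 0\<close> the value at 0 is \<open>Infty\<close> and 0 is the only pole;
  otherwise \<open>g_diff\<close> forces \<open>z\<^sup>2 = 0\<close>.\<close>

lemma fibre_sphere_map_0: "fibre M g (sphere_map g 0) = {0}"
proof -
  have "z = 0" if eq: "sphere_map g z = sphere_map g 0" for z
  proof (cases "t = 0")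
    case True
    then show ?thesis using eq unfolding sphere_map_g by (simp split: if_splits)
  next
    case False
    then have "z\<^sup>2 + of_real t \<noteq> 0" "g z = g 0"
      using eq unfolding sphere_map_g by (simp_all split: if_splits)
    then show ?thesis using g_diff[of 0 z] False sigma_nonzero A_neq_B by simp
  qed
  moreover have "0 \<in> M" by (simp add: in_M_iff)
  ultimately show ?thesis unfolding fibre_def by blast
qed

lemma nonexceptional_totally_ramified:
  "{b. totally_ramified_value M g b \<and> \<not> exceptional_value M g b} = {sphere_map g 0}"
proof -
  have "b = sphere_map g 0" if b: "totally_ramified_value M g b" "\<not> exceptional_value M g b" for b
  proof -
    obtain z where z: "z \<in> fibre M g b" using b(2) by (auto simp: exceptional_value_def)
    then have "mult_at g z \<ge> 2" using b(1) by (simp add: totally_ramified_value_def)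
    then have "z = 0" unfolding mult_at_g by (simp split: if_splits)
    then show ?thesis using z by (simp add: fibre_def)
  qed
  moreover have "totally_ramified_value M g (sphere_map g 0)" "\<not> exceptional_value M g (sphere_map g 0)"
    by (simp_all add: totally_ramified_value_def exceptional_value_def fibre_sphere_map_0 mult_at_g)
  ultimately show ?thesis by blast
qed

lemma finite_totally_ramified: "finite {b. totally_ramified_value M g b}"
proof (rule finite_subset)
  show "{b. totally_ramified_value M g b} \<subseteq> {b. exceptional_value M g b}
      \<union> {b. totally_ramified_value M g b \<and> \<not> exceptional_value M g b}"
    by blast
qed (simp only: exceptional_values nonexceptional_totally_ramified finite_Un finite_insert finite.emptyI)

lemma totally_ramified_value_number_example: "totally_ramified_value_number M g = 5 / 2"
proof -
  have "min_mult M g (sphere_map g 0) = 2"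
    by (simp add: min_mult_def fibre_sphere_map_0 mult_at_g)
  \<comment> \<open>The two exceptional values are distinct and count 2; the double value at 0 adds
    1/2.\<close>
  moreover have "\<sigma> \<noteq> \<sigma> * of_real a"
    using sigma_nonzero a_neq_1 by simp
  then have "card {Fin \<sigma>, Fin (\<sigma> * of_real a)} = 2" by simp
  ultimately show ?thesis
    unfolding totally_ramified_value_number_def exceptional_values nonexceptional_totally_ramified by simp
qed

lemma algebraic_minimal_surface_example:
  assumes "z0 \<in> M"
  shows "algebraic_minimal_surface M (weierstrass_immersion M z0 h g)"
  unfolding algebraic_minimal_surface_def
  using spinor_immersion.minimal_surface_X[OF ws.spinor_immersion_weierstrass[OF assms]]
    complete_example[OF assms] finite_total_curvature_example[OF assms] by blast

end

theorem theorem3p19: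
  fixes a t :: real and \<sigma> z0 :: complex
    and M :: "complex set" and g h :: "complex \<Rightarrow> complex" and X :: "complex \<Rightarrow> real^3"
  assumes "(a - 1) * (t - 1) \<noteq> 0"
    and "a * ((t - 1) * a + 4) \<noteq> 0"
    and "(t + 3) / (a * ((t - 1) * a + 4)) < 0"
    and "\<sigma>\<^sup>2 = of_real ((t + 3) / (a * ((t - 1) * a + 4)))"
    and "M = UNIV - {\<i>, - \<i>}"
    and "g = (\<lambda>z. \<sigma> * ((z\<^sup>2 + 1 + of_real a * (of_real t - 1)) / (z\<^sup>2 + of_real t)))"
    and "h = (\<lambda>z. (z\<^sup>2 + of_real t)\<^sup>2 / (z\<^sup>2 + 1)\<^sup>2)"
    and "z0 \<in> M"
    and "X = weierstrass_immersion M z0 h g"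
  shows "weierstrass_data M h g
       \<and> algebraic_minimal_surface M X
       \<and> (\<forall>z\<in>M. gauss_map X z = sphere_map g z)
       \<and> finite {b. totally_ramified_value M g b}
       \<and> totally_ramified_value_number M g = 5 / 2"
proof -
  interpret E: gauss_example a t \<sigma>
    by unfold_locales (use assms in auto)
  have eqs: "M = E.M" "g = E.g" "h = E.h"
    using assms by (simp_all add: fun_eq_iff E.M_def E.g_def E.h_def)
  show ?thesis
    using E.weierstrass_data_example E.algebraic_minimal_surface_example E.gauss_map_example
      E.finite_totally_ramified E.totally_ramified_value_number_example \<open>z0 \<in> M\<close>
    unfolding \<open>X = _\<close> eqs by blast
qed

end
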